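(* Let $p\geq 2$ and let $G$ be a finite simple $\{pK_2, K_5-e\}$-free graph. Then $\chi(G)\leq f_p(\omega(G))$, where $f_p:\mathbb{N}\to\mathbb{N}$ ($p\geq2$) is defined as follows. First let $g_p$ ($p\geq2$) be given by $g_t(1)=1$ ($t\geq2$), $g_2(2)=3$, $g_2(m)=m$ ($m\geq3$), $g_p(2)=2p-2$ ($p\geq3$), $g_p(m)=g_{p-1}(m)+2m-2$ ($p,m\geq3$). Then $f_t(1)=1$ for $t\geq 2$; $f_2(2)=3$; $f_2(3)=4$; $f_2(4)=6$; $f_2(s)=s$ for $s\geq 5$; $f_p(2)=2p-2$ and $f_p(3)=2p^2-3p+4$ for $p\geq 3$; and $f_p(m)=f_{p-1}(m)+2g_{p-1}(m-1)+3m-6$ for $p\geq 3$, $m\geq 4$.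
   Context: $\chi(G)$ is the chromatic number and $\omega(G)$ the clique number of $G$. $pK_2$ is the disjoint union of $p$ edges; $K_5-e$ is the complete graph on five vertices minus one edge. A graph is $\mathcal{F}$-free if it has no induced subgraph isomorphic to a member of $\mathcal{F}$. *)

theory Defs
  imports "Graph_Theory.Graph_Theory"
begin

text \<open>
  A finite simple graph is a \<^locale>\<open>pair_graph\<close>: finite, loop-free and symmetric, so that an
  undirected edge between u and v is the pair of arcs (u,v) and (v,u).
\<close>

definition proper_coloring :: "'a pair_pre_digraph \<Rightarrow> nat \<Rightarrow> ('a \<Rightarrow> nat) \<Rightarrow> bool" where
  "proper_coloring G k c \<longleftrightarrow>
     (\<forall>v \<in> pverts G. c v < k) \<and> (\<forall>(u, v) \<in> parcs G. c u \<noteq> c v)"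

definition chromatic_number :: "'a pair_pre_digraph \<Rightarrow> nat" where
  "chromatic_number G = (LEAST k. \<exists>c. proper_coloring G k c)"

definition clique_in :: "'a pair_pre_digraph \<Rightarrow> 'a set \<Rightarrow> bool" where
  "clique_in G S \<longleftrightarrow> S \<subseteq> pverts G \<and> (\<forall>u \<in> S. \<forall>v \<in> S. u \<noteq> v \<longrightarrow> (u, v) \<in> parcs G)"

definition clique_number :: "'a pair_pre_digraph \<Rightarrow> nat" where
  "clique_number G = Max (card ` {S. clique_in G S})"

definition family_free :: "'b pair_pre_digraph set \<Rightarrow> 'a pair_pre_digraph \<Rightarrow> bool" where
  "family_free F G \<longleftrightarrow>
     \<not> (\<exists>H \<in> F. \<exists>K. induced_subgraph K (with_proj G) \<and> digraph_iso K (with_proj H))"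

text \<open>The edges of the disjoint union of p edges are the pairs {2i, 2i+1} for i < p.\<close>

definition pK2 :: "nat \<Rightarrow> nat pair_pre_digraph" where
  "pK2 p = \<lparr> pverts = {..<2 * p},
     parcs = {(u, v). u < 2 * p \<and> v < 2 * p \<and> u \<noteq> v \<and> u div 2 = v div 2} \<rparr>"

definition K5_minus_e :: "nat pair_pre_digraph" where
  "K5_minus_e = \<lparr> pverts = {..<5},
     parcs = {(u, v). u < 5 \<and> v < 5 \<and> u \<noteq> v} - {(0, 1), (1, 0)} \<rparr>"

text \<open>
  Only arguments p \<ge> 2 and m \<ge> 1 are meaningful for the two bounding functions below. The value 0
  at m = 0 is the one fitting the graph without vertices; the values at p < 2 are those at p = 2
  and are never used.
\<close>

fun gbound :: "nat \<Rightarrow> nat \<Rightarrow> nat" where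
  "gbound p m =
    (if m = 0 then 0
     else if m = 1 then 1
     else if p \<le> 2 then (if m = 2 then 3 else m)
     else if m = 2 then 2 * p - 2
     else gbound (p - 1) m + (2 * m - 2))"

fun fbound :: "nat \<Rightarrow> nat \<Rightarrow> nat" where
  "fbound p m =
    (if m = 0 then 0
     else if m = 1 then 1
     else if p \<le> 2 then (if m = 2 then 3 else if m = 3 then 4 else if m = 4 then 6 else m)
     else if m = 2 then 2 * p - 2
     else if m = 3 then 2 * p ^ 2 - 3 * p + 4
     else fbound (p - 1) m + 2 * gbound (p - 1) (m - 1) + (3 * m - 6))"

declare gbound.simps [simp del] fbound.simps [simp del]

lemma gbound_eqs:
  "gbound p 1 = 1"
  "gbound 2 2 = 3"
  "m \<ge> 3 \<Longrightarrow> gbound 2 m = m"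
  "p \<ge> 3 \<Longrightarrow> gbound p 2 = 2 * p - 2"
  "p \<ge> 3 \<Longrightarrow> m \<ge> 3 \<Longrightarrow> gbound p m = gbound (p - 1) m + 2 * m - 2"
  by (subst gbound.simps; simp)+

lemma fbound_eqs:
  "fbound p 1 = 1"
  "fbound 2 2 = 3"
  "fbound 2 3 = 4"
  "fbound 2 4 = 6"
  "m \<ge> 5 \<Longrightarrow> fbound 2 m = m"
  "p \<ge> 3 \<Longrightarrow> fbound p 2 = 2 * p - 2"
  "p \<ge> 3 \<Longrightarrow> int (fbound p 3) = 2 * int p ^ 2 - 3 * int p + 4"
  "p \<ge> 3 \<Longrightarrow> m \<ge> 4 \<Longrightarrow>
     fbound p m = fbound (p - 1) m + 2 * gbound (p - 1) (m - 1) + 3 * m - 6"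
proof -
  assume "p \<ge> 3"
  then have "3 * p \<le> 2 * p ^ 2" by (simp add: power2_eq_square)
  with \<open>p \<ge> 3\<close> show "int (fbound p 3) = 2 * int p ^ 2 - 3 * int p + 4"
    by (subst fbound.simps) (simp add: of_nat_diff)
qed (subst fbound.simps; simp)+

end

theory Submission
  imports Defs
begin

text \<open>
  Write A for the vertices adjacent to neither end of an edge xy; A contains one induced matching
  edge less than the whole graph. If xyz is a triangle, the vertices outside A are covered by the
  private neighbours of x missing yz, those of y missing xz, and the common neighbours of the three
  pairs; the former induce (p-1)K2-free diamond-free graphs, the latter disjoint unions of cliques.
  This gives the recursions of both bounds. For p = 2 a graph without K_(k+2) minus an edge is
  colored along a maximum clique if that has at least 2k - 1 vertices: a vertex outside sees fewer
  than k of them and an edge outside misses at most one, so its ends have no common neighbour in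
  the clique. The base cases that are not elementary are the 4-colorability of 2K2-free K4-free
  graphs and of 3K2-free triangle-free graphs.

  Those two are proved for a vertex-critical counterexample by excluding small induced subgraphs H
  one after the other. H is excluded in one of two ways: either the adjacencies of a vertex to H
  already determine a proper 4-coloring, because two vertices of equal color cannot be adjacent
  without creating a subgraph excluded before; or some vertex u of H has its neighbourhood in H
  contained in that of a non-neighbour w, and every vertex adjacent to u but not to w would create
  such a subgraph. The sequence of subgraphs was found by computer search and is checked by
  rewriting.
\<close>


section \<open>Cliques, induced matchings and colorings\<close>

locale simple_graph =
  fixes E :: "'a \<Rightarrow> 'a \<Rightarrow> bool"
  assumes adj_sym: "E x y \<Longrightarrow> E y x" and adj_irrefl: "\<not> E x x"
begin

lemma adj_commute: "E x y \<longleftrightarrow> E y x"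
  using adj_sym by blast

definition nbrs :: "'a set \<Rightarrow> 'a \<Rightarrow> 'a set" where
  "nbrs S v = {x \<in> S. E v x}"

definition missing :: "'a set \<Rightarrow> 'a \<Rightarrow> 'a \<Rightarrow> 'a set" where
  "missing S u v = {x \<in> S. \<not> E u x \<and> \<not> E v x}"

lemma mem_nbrs [simp]: "x \<in> nbrs S v \<longleftrightarrow> x \<in> S \<and> E v x"
  by (simp add: nbrs_def)

lemma mem_missing [simp]: "x \<in> missing S u v \<longleftrightarrow> x \<in> S \<and> \<not> E u x \<and> \<not> E v x"
  by (simp add: missing_def)

lemma nbrs_subset [simp]: "nbrs S v \<subseteq> S"
  by auto

lemma finite_nbrs [simp]: "finite S \<Longrightarrow> finite (nbrs S v)"
  by (simp add: nbrs_def)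

lemma missing_subset [simp]: "missing S u v \<subseteq> S"
  by auto

lemma finite_missing [simp]: "finite S \<Longrightarrow> finite (missing S u v)"
  by (simp add: missing_def)

definition stable :: "'a set \<Rightarrow> bool" where
  "stable S \<longleftrightarrow> (\<forall>u\<in>S. \<forall>v\<in>S. \<not> E u v)"

lemma stableD: "\<lbrakk>stable S; u \<in> S; v \<in> S\<rbrakk> \<Longrightarrow> \<not> E u v"
  by (simp add: stable_def)

lemma stable_mono: "stable S \<Longrightarrow> T \<subseteq> S \<Longrightarrow> stable T"
  unfolding stable_def by blast

lemma stable_Un:
  "\<lbrakk>stable S; stable T; \<And>u v. \<lbrakk>u \<in> S; v \<in> T\<rbrakk> \<Longrightarrow> \<not> E u v\<rbrakk> \<Longrightarrow> stable (S \<union> T)"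
  using adj_sym unfolding stable_def by blast

definition has_clique :: "nat \<Rightarrow> 'a set \<Rightarrow> bool" where
  "has_clique k S \<longleftrightarrow> (\<exists>K\<subseteq>S. finite K \<and> card K = k \<and> pairwise E K)"

lemma has_cliqueI: "\<lbrakk>K \<subseteq> S; finite K; card K = k; pairwise E K\<rbrakk> \<Longrightarrow> has_clique k S"
  unfolding has_clique_def by blast

lemma has_cliqueE:
  assumes "has_clique k S"
  obtains K where "K \<subseteq> S" "finite K" "card K = k" "pairwise E K"
  using assms unfolding has_clique_def by blast

lemma has_clique_mono: "has_clique k S \<Longrightarrow> S \<subseteq> T \<Longrightarrow> has_clique k T"
  unfolding has_clique_def by blast

lemma has_clique_le:
  assumes "has_clique k S" "l \<le> k"
  shows "has_clique l S"
proof -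
  obtain K where K: "K \<subseteq> S" "card K = k" "pairwise E K"
    using assms(1) by (rule has_cliqueE)
  obtain L where "L \<subseteq> K" "card L = l" "finite L"
    using obtain_subset_with_card_n[of l K] assms(2) K(2) by auto
  then show ?thesis using K pairwise_subset by (intro has_cliqueI[of L]) auto
qed

lemma clique_insert: "pairwise E K \<Longrightarrow> (\<And>x. x \<in> K \<Longrightarrow> E u x) \<Longrightarrow> pairwise E (insert u K)"
  by (auto simp: pairwise_insert intro: adj_sym)

lemma has_clique_Suc: "has_clique (Suc k) S \<longleftrightarrow> (\<exists>a\<in>S. has_clique k (nbrs S a))"
proof
  assume "has_clique (Suc k) S"
  then obtain K where K: "K \<subseteq> S" "finite K" "card K = Suc k" "pairwise E K"
    by (rule has_cliqueE)
  then obtain a where a: "a \<in> K" by fastforce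
  have "K - {a} \<subseteq> nbrs S a" using K(1,4) a by (fastforce simp: pairwise_def)
  then have "has_clique k (nbrs S a)"
    using K a by (intro has_cliqueI[of "K - {a}"]) (auto simp: pairwise_def)
  then show "\<exists>a\<in>S. has_clique k (nbrs S a)" using a K(1) by blast
next
  assume "\<exists>a\<in>S. has_clique k (nbrs S a)"
  then obtain a K where a: "a \<in> S" and K: "K \<subseteq> nbrs S a" "finite K" "card K = k" "pairwise E K"
    unfolding has_clique_def by blast
  have "a \<notin> K" using K(1) adj_irrefl by auto
  then show "has_clique (Suc k) S"
    using a K by (intro has_cliqueI[of "insert a K"] clique_insert) auto
qed

lemma has_clique_0: "has_clique 0 S"
  by (rule has_cliqueI[of "{}"]) auto

lemma has_clique_1_iff: "has_clique 1 S \<longleftrightarrow> (\<exists>a. a \<in> S)"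
  by (auto simp: has_clique_Suc has_clique_0)

lemma has_clique_2_iff: "has_clique 2 S \<longleftrightarrow> (\<exists>a\<in>S. \<exists>b\<in>S. E a b)"
  by (auto simp: numeral_eq_Suc has_clique_Suc has_clique_0)

lemma has_clique_3_iff:
  "has_clique 3 S \<longleftrightarrow> (\<exists>a\<in>S. \<exists>b\<in>S. \<exists>c\<in>S. E a b \<and> E a c \<and> E b c)"
  by (simp add: numeral_eq_Suc has_clique_Suc has_clique_0 Bex_def)

lemma has_clique_4_iff:
  "has_clique 4 S \<longleftrightarrow> (\<exists>a\<in>S. \<exists>b\<in>S. \<exists>c\<in>S. \<exists>d\<in>S. E a b \<and> E a c \<and> E b c \<and> E a d \<and> E b d \<and> E c d)"
  by (simp add: numeral_eq_Suc has_clique_Suc has_clique_0 Bex_def)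

lemma obtain_clique_number:
  assumes "\<not> has_clique (Suc m) S"
  obtains i where "i \<le> m" "has_clique i S" "\<not> has_clique (Suc i) S"
proof -
  have "\<exists>i\<le>m. has_clique i S \<and> \<not> has_clique (Suc i) S"
    using assms
  proof (induction m)
    case (Suc m)
    then show ?case by (cases "has_clique (Suc m) S") (auto intro: le_SucI)
  qed (simp add: has_clique_0)
  then show ?thesis using that by blast
qed

primrec has_induced_matching :: "nat \<Rightarrow> 'a set \<Rightarrow> bool" where
  "has_induced_matching 0 S \<longleftrightarrow> True"
| "has_induced_matching (Suc k) S \<longleftrightarrow> (\<exists>a\<in>S. \<exists>b\<in>S. E a b \<and> has_induced_matching k (missing S a b))"

lemma has_induced_matching_mono: "has_induced_matching k S \<Longrightarrow> S \<subseteq> T \<Longrightarrow> has_induced_matching k T"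
proof (induction k arbitrary: S T)
  case (Suc k)
  then obtain a b where ab: "a \<in> S" "b \<in> S" "E a b" "has_induced_matching k (missing S a b)"
    by auto
  have "missing S a b \<subseteq> missing T a b" using Suc.prems(2) by auto
  then have "has_induced_matching k (missing T a b)" using Suc.IH ab(4) by blast
  then show ?case using ab(1-3) Suc.prems(2) by auto
qed simp

lemma has_induced_matching_2_iff:
  "has_induced_matching 2 S \<longleftrightarrow> (\<exists>a\<in>S. \<exists>b\<in>S. \<exists>c\<in>missing S a b. \<exists>d\<in>missing S a b. E a b \<and> E c d)"
  by (auto simp: numeral_2_eq_2)

lemma has_induced_matching_3_iff:
  "has_induced_matching 3 S \<longleftrightarrow> (\<exists>a\<in>S. \<exists>b\<in>S. E a b \<and> has_induced_matching 2 (missing S a b))"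
  by (simp add: numeral_eq_Suc)

lemma not_has_induced_matching_missing:
  "\<lbrakk>\<not> has_induced_matching (Suc k) S; a \<in> S; b \<in> S; E a b\<rbrakk>
    \<Longrightarrow> \<not> has_induced_matching k (missing S a b)"
  by auto

lemma stable_missing:
  "\<lbrakk>\<not> has_induced_matching 2 S; a \<in> S; b \<in> S; E a b\<rbrakk> \<Longrightarrow> stable (missing S a b)"
  unfolding stable_def has_induced_matching_2_iff by blast

lemma stable_nbrs: "\<not> has_clique 3 S \<Longrightarrow> a \<in> S \<Longrightarrow> stable (nbrs S a)"
  unfolding stable_def has_clique_3_iff Ball_def mem_nbrs by blast

lemma not_has_clique_nbrs: "\<not> has_clique (Suc k) S \<Longrightarrow> a \<in> S \<Longrightarrow> \<not> has_clique k (nbrs S a)"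
  by (simp add: has_clique_Suc)

definition colorable :: "'a set \<Rightarrow> nat \<Rightarrow> bool" where
  "colorable S k \<longleftrightarrow>
     (\<exists>c :: 'a \<Rightarrow> nat. (\<forall>v\<in>S. c v < k) \<and> (\<forall>u\<in>S. \<forall>v\<in>S. E u v \<longrightarrow> c u \<noteq> c v))"

lemma colorableE:
  assumes "colorable S k"
  obtains c :: "'a \<Rightarrow> nat" where "\<And>v. v \<in> S \<Longrightarrow> c v < k"
    and "\<And>u v. \<lbrakk>u \<in> S; v \<in> S; E u v\<rbrakk> \<Longrightarrow> c u \<noteq> c v"
  using assms unfolding colorable_def by blast

lemma colorableI:
  assumes "finite C" "card C \<le> k" and "\<And>v. v \<in> S \<Longrightarrow> c v \<in> C"
    and "\<And>u v. \<lbrakk>u \<in> S; v \<in> S; E u v\<rbrakk> \<Longrightarrow> c u \<noteq> c v"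
  shows "colorable S k"
proof -
  obtain h where "bij_betw h C {0..<card C}"
    using ex_bij_betw_finite_nat[OF assms(1)] by blast
  then have h: "inj_on h C" "h ` C = {0..<card C}" by (auto simp: bij_betw_def)
  have "h (c v) < k" if "v \<in> S" for v
    using imageI[OF assms(3)[OF that], of h] h(2) assms(2) by simp
  moreover have "h (c u) \<noteq> h (c v)" if "u \<in> S" "v \<in> S" "E u v" for u v
    using inj_on_eq_iff[OF h(1)] assms(3,4) that by simp
  ultimately show ?thesis unfolding colorable_def by (intro exI[of _ "\<lambda>v. h (c v)"]) blast
qed

lemma colorable_mono:
  assumes "colorable S k" "T \<subseteq> S" "k \<le> l"
  shows "colorable T l"
proof -
  obtain c where "\<And>v. v \<in> S \<Longrightarrow> c v < k" "\<And>u v. \<lbrakk>u \<in> S; v \<in> S; E u v\<rbrakk> \<Longrightarrow> c u \<noteq> c v"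
    using assms(1) by (rule colorableE) blast
  then show ?thesis using assms(2,3) by (intro colorableI[of "{..<l}" _ _ c]) fastforce+
qed

lemma colorable_Un:
  assumes "colorable S k" "colorable T l"
  shows "colorable (S \<union> T) (k + l)"
proof -
  obtain c where c: "\<And>v. v \<in> S \<Longrightarrow> c v < k" "\<And>u v. \<lbrakk>u \<in> S; v \<in> S; E u v\<rbrakk> \<Longrightarrow> c u \<noteq> c v"
    using assms(1) by (rule colorableE) blast
  obtain d where d: "\<And>v. v \<in> T \<Longrightarrow> d v < l" "\<And>u v. \<lbrakk>u \<in> T; v \<in> T; E u v\<rbrakk> \<Longrightarrow> d u \<noteq> d v"
    using assms(2) by (rule colorableE) blast
  show ?thesis
  proof (rule colorableI)
    show "card ({..<k} <+> {..<l}) \<le> k + l" by (simp add: card_Plus)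
    show "(if v \<in> S then Inl (c v) else Inr (d v)) \<in> {..<k} <+> {..<l}" if "v \<in> S \<union> T" for v
      using that c(1) d(1) by auto
    show "(if u \<in> S then Inl (c u) else Inr (d u)) \<noteq> (if v \<in> S then Inl (c v) else Inr (d v))"
      if "u \<in> S \<union> T" "v \<in> S \<union> T" "E u v" for u v
      using that c(2)[of u v] d(2)[of u v] by auto
  qed simp
qed

lemma colorable_stable: "stable S \<Longrightarrow> colorable S 1"
  by (rule colorableI[of "{()}"]) (auto simp: stable_def)

lemma colorable_insert:
  assumes "colorable S k" "finite (nbrs S v)" "card (nbrs S v) < k"
  shows "colorable (insert v S) k"
proof -
  obtain c where c: "\<And>x. x \<in> S \<Longrightarrow> c x < k" "\<And>x y. \<lbrakk>x \<in> S; y \<in> S; E x y\<rbrakk> \<Longrightarrow> c x \<noteq> c y"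
    using assms(1) by (rule colorableE) blast
  have "\<not> {..<k} \<subseteq> c ` nbrs S v"
  proof
    assume "{..<k} \<subseteq> c ` nbrs S v"
    then have "k \<le> card (c ` nbrs S v)" using card_mono[of "c ` nbrs S v" "{..<k}"] assms(2) by simp
    then show False using card_image_le[OF assms(2), of c] assms(3) by linarith
  qed
  then obtain i where i: "i < k" "i \<notin> c ` nbrs S v" by blast
  show ?thesis
  proof (rule colorableI)
    show "(c(v := i)) x \<in> {..<k}" if "x \<in> insert v S" for x using that c(1) i(1) by auto
    show "(c(v := i)) x \<noteq> (c(v := i)) y" if "x \<in> insert v S" "y \<in> insert v S" "E x y" for x y
      using that c(2) i(2) adj_irrefl[of v] adj_sym[OF that(3)] by auto
  qed simp_all
qed

lemma colorable_insert_isolated: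
  "\<lbrakk>colorable S k; nbrs S v = {}; 0 < k\<rbrakk> \<Longrightarrow> colorable (insert v S) k"
  by (rule colorable_insert) auto

lemma colorable_0: "\<not> has_clique 1 S \<Longrightarrow> colorable S 0"
  unfolding has_clique_1_iff by (simp add: colorable_def)

lemma colorable_1: "\<not> has_clique 2 S \<Longrightarrow> colorable S 1"
  by (rule colorable_stable) (simp add: stable_def has_clique_2_iff)

lemma colorable_edge_partition:
  assumes "colorable (missing S x y) k" "colorable (nbrs S x) l" "colorable (nbrs S y) l"
  shows "colorable S (k + 2 * l)"
  by (rule colorable_mono[OF colorable_Un[OF assms(1) colorable_Un[OF assms(2,3)]]]) auto

definition critical :: "'a set \<Rightarrow> nat \<Rightarrow> bool" where
  "critical S k \<longleftrightarrow> \<not> colorable S k \<and> (\<forall>v\<in>S. colorable (S - {v}) k)"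

lemma critical_subset:
  assumes "finite S" "\<not> colorable S k"
  obtains T where "T \<subseteq> S" "critical T k"
  using assms
proof (induction S arbitrary: thesis rule: finite_psubset_induct)
  case (psubset S)
  show ?case
  proof (cases "critical S k")
    case False
    then obtain v where v: "v \<in> S" "\<not> colorable (S - {v}) k"
      using psubset.prems(2) unfolding critical_def by blast
    show ?thesis
      by (rule psubset.IH[of "S - {v}"]) (use v psubset.prems(1) in auto)
  qed (use psubset.prems(1) in blast)
qed

lemma critical_nbrs_not_subset:
  assumes crit: "critical S k" and uw: "u \<in> S" "w \<in> S" "u \<noteq> w" "\<not> E u w"
  shows "\<not> nbrs S u \<subseteq> nbrs S w"
proof
  assume sub: "nbrs S u \<subseteq> nbrs S w"
  have "colorable (S - {u}) k" using crit uw(1) by (simp add: critical_def)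
  then obtain c where c: "\<And>v. v \<in> S - {u} \<Longrightarrow> c v < k"
    "\<And>x y. \<lbrakk>x \<in> S - {u}; y \<in> S - {u}; E x y\<rbrakk> \<Longrightarrow> c x \<noteq> c y"
    by (rule colorableE) blast
  have recolor: "c x \<noteq> c w" if "x \<in> S" "E u x" for x
  proof -
    have "E w x" using sub that by auto
    then show ?thesis using c(2)[of x w] that uw adj_irrefl[of u] adj_sym[of w x] by auto
  qed
  have "colorable S k"
  proof (rule colorableI)
    show "(c(u := c w)) v \<in> {..<k}" if "v \<in> S" for v using that c(1) uw by auto
    show "(c(u := c w)) x \<noteq> (c(u := c w)) y" if "x \<in> S" "y \<in> S" "E x y" for x y
      using that c(2)[of x y] recolor[of x] recolor[of y, THEN not_sym] adj_irrefl[of u]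
        adj_sym[OF that(3)]
      by (cases "x = u"; cases "y = u") auto
  qed simp_all
  then show False using crit unfolding critical_def by blast
qed

section \<open>Complete graphs minus an edge\<close>

text \<open>The forbidden graph has \<open>k + 2\<close> vertices: 1, 2, 3 give the path P3, the diamond and K5 - e.\<close>

definition clique_minus_edge_free :: "nat \<Rightarrow> 'a set \<Rightarrow> bool" where
  "clique_minus_edge_free k S \<longleftrightarrow>
     (\<forall>K\<subseteq>S. \<forall>a\<in>S. \<forall>b\<in>S. finite K \<and> card K = k \<and> pairwise E K \<and>
        (\<forall>x\<in>K. E a x \<and> E b x) \<and> a \<noteq> b \<longrightarrow> E a b)"

lemma clique_minus_edge_freeD:
  "\<lbrakk>clique_minus_edge_free k S; K \<subseteq> S; finite K; card K = k; pairwise E K; a \<in> S; b \<in> S;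
    \<And>x. x \<in> K \<Longrightarrow> E a x; \<And>x. x \<in> K \<Longrightarrow> E b x; a \<noteq> b\<rbrakk> \<Longrightarrow> E a b"
  unfolding clique_minus_edge_free_def by blast

lemma clique_minus_edge_free_mono:
  "clique_minus_edge_free k S \<Longrightarrow> T \<subseteq> S \<Longrightarrow> clique_minus_edge_free k T"
  unfolding clique_minus_edge_free_def by (meson order_trans subsetD)

lemma clique_minus_edge_free_nbrs:
  assumes "clique_minus_edge_free (Suc k) S" "v \<in> S"
  shows "clique_minus_edge_free k (nbrs S v)"
  unfolding clique_minus_edge_free_def
proof (intro allI ballI impI, elim conjE)
  fix K a b
  assume K: "K \<subseteq> nbrs S v" "finite K" "card K = k" "pairwise E K"
    and ab: "a \<in> nbrs S v" "b \<in> nbrs S v" "\<forall>x\<in>K. E a x \<and> E b x" "a \<noteq> b"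
  have "v \<notin> K" "K \<subseteq> S" using K(1) adj_irrefl by auto
  moreover have "pairwise E (insert v K)" using K(1,4) by (intro clique_insert) auto
  moreover have "E a v" "E b v" using ab adj_sym by auto
  ultimately show "E a b"
    using clique_minus_edge_freeD[OF assms(1), of "insert v K" a b] assms(2) K ab by auto
qed

lemma clique_minus_edge_free_if_not_has_clique:
  assumes "\<not> has_clique (Suc k) S"
  shows "clique_minus_edge_free k S"
  unfolding clique_minus_edge_free_def
proof (intro allI ballI impI, elim conjE)
  fix K a b
  assume K: "K \<subseteq> S" "finite K" "card K = k" "pairwise E K" and a: "a \<in> S" "\<forall>x\<in>K. E a x \<and> E b x"
  have "a \<notin> K" using a(2) adj_irrefl by blast
  then have "has_clique (Suc k) S"
    using K a by (intro has_cliqueI[of "insert a K"] clique_insert) auto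
  then show "E a b" using assms by blast
qed

lemma colorable_P3_free:
  assumes "finite S" "clique_minus_edge_free 1 S" "\<not> has_clique (Suc k) S"
  shows "colorable S k"
  using assms
proof (induction S rule: finite_induct)
  case empty
  show ?case by (simp add: colorable_def)
next
  case (insert v S)
  have IH: "colorable S k"
    using insert.IH insert.prems clique_minus_edge_free_mono has_clique_mono
    by (meson subset_insertI)
  have "E x y" if "x \<in> nbrs S v" "y \<in> nbrs S v" "x \<noteq> y" for x y
    using clique_minus_edge_freeD[OF insert.prems(1), of "{v}" x y] that
      adj_sym[of v x] adj_sym[of v y] by auto
  then have "pairwise E (nbrs S v)" by (auto simp: pairwise_def)
  then have "has_clique (Suc (card (nbrs S v))) (insert v S)"
    using insert.hyps by (intro has_cliqueI[of "insert v (nbrs S v)"] clique_insert) auto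
  then have "card (nbrs S v) < k"
    using has_clique_le[of _ _ "Suc k"] insert.prems(2) by (meson Suc_le_mono not_less)
  then show ?case using colorable_insert[OF IH] insert.hyps(1) by simp
qed

definition maximum_clique :: "'a set \<Rightarrow> 'a set \<Rightarrow> bool" where
  "maximum_clique K S \<longleftrightarrow>
     K \<subseteq> S \<and> finite K \<and> pairwise E K \<and> \<not> has_clique (Suc (card K)) S"

lemma maximum_cliqueD:
  assumes "maximum_clique K S"
  shows "K \<subseteq> S" "finite K" "pairwise E K" "\<not> has_clique (Suc (card K)) S"
  using assms by (auto simp: maximum_clique_def)

lemma obtain_maximum_clique:
  assumes "has_clique m S" "\<not> has_clique (Suc m) S"
  obtains K where "maximum_clique K S" "card K = m"
  using assms by (metis has_cliqueE maximum_clique_def)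

lemma card_nbrs_maximum_clique:
  assumes max: "maximum_clique K S" and free: "clique_minus_edge_free k S" and u: "u \<in> S - K"
  shows "card (nbrs K u) < k"
proof (rule ccontr)
  note clique = maximum_cliqueD[OF max]
  assume "\<not> card (nbrs K u) < k"
  then obtain L where L: "L \<subseteq> nbrs K u" "card L = k" "finite L"
    by (metis not_less obtain_subset_with_card_n)
  have "E u z" if z: "z \<in> K" for z
  proof (cases "z \<in> L")
    case False
    have "L \<subseteq> K" using L(1) by auto
    moreover from this have "pairwise E L" using clique(3) pairwise_subset by blast
    moreover have "E z x" if "x \<in> L" for x
      by (rule pairwiseD(1)[OF clique(3) z]) (use \<open>L \<subseteq> K\<close> False that in auto)
    moreover have "E u x" if "x \<in> L" for x using L(1) that by auto
    ultimately show ?thesis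
      using clique_minus_edge_freeD[OF free, of L u z] L(2,3) u z clique(1) by auto
  qed (use L(1) in auto)
  then have "has_clique (Suc (card K)) S"
    using u clique by (intro has_cliqueI[of "insert u K"] clique_insert) auto
  then show False using clique(4) by blast
qed

lemma not_subset_nbrs_maximum_clique:
  assumes "maximum_clique K S" "clique_minus_edge_free k S" "u \<in> S - K" "card L = k"
  shows "\<not> L \<subseteq> nbrs K u"
  using card_nbrs_maximum_clique[OF assms(1-3)] card_mono[of "nbrs K u" L]
    maximum_cliqueD(2)[OF assms(1)] assms(4) by auto

section \<open>2K2-free graphs\<close>

lemma edge_adjacent_to_edge:
  assumes "\<not> has_induced_matching 2 S" "a \<in> S" "b \<in> S" "E a b" "u \<in> S" "v \<in> S" "E u v"
  shows "E u a \<or> E u b \<or> E v a \<or> E v b"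
  using stableD[OF stable_missing[OF assms(1-4)], of u v] assms(5-)
    adj_commute[of a] adj_commute[of b] by auto

lemma card_clique_le_nbrs_of_edge:
  assumes "\<not> has_induced_matching 2 S" and K: "K \<subseteq> S" "finite K" "pairwise E K"
    and uv: "u \<in> S" "v \<in> S" "E u v"
  shows "card K \<le> card (nbrs K u \<union> nbrs K v) + 1"
proof -
  let ?L = "K - (nbrs K u \<union> nbrs K v)"
  have "x = y" if xy: "x \<in> ?L" "y \<in> ?L" for x y
  proof (rule ccontr)
    assume "x \<noteq> y"
    then have "E x y" using pairwiseD(1)[OF K(3)] xy by blast
    then show False using edge_adjacent_to_edge[OF assms(1), of x y u v] xy K(1) uv by auto
  qed
  then have "card ?L \<le> 1" using card_le_Suc0_iff_eq[of ?L] K(2) by auto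
  then show ?thesis
    using diff_card_le_card_Diff[of "nbrs K u \<union> nbrs K v" K] K(2) by simp
qed

lemma nbrs_of_edge_disjoint:
  assumes no_2K2: "\<not> has_induced_matching 2 S" and max: "maximum_clique K S"
    and free: "clique_minus_edge_free k S" and large: "2 * k - 1 \<le> card K"
    and uv: "u \<in> S - K" "v \<in> S - K" "E u v"
  shows "nbrs K u \<inter> nbrs K v = {}"
proof -
  note clique = maximum_cliqueD[OF max]
  have fin: "finite (nbrs K w)" for w using clique(2) by simp
  have "card K \<le> card (nbrs K u \<union> nbrs K v) + 1"
    using card_clique_le_nbrs_of_edge[OF no_2K2 clique(1-3)] uv by blast
  moreover have "card (nbrs K u) < k" "card (nbrs K v) < k"
    using card_nbrs_maximum_clique[OF max free] uv by auto
  ultimately have "card (nbrs K u \<inter> nbrs K v) = 0"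
    using card_Un_Int[OF fin fin, of u v] large by linarith
  then show ?thesis using fin by simp
qed

text \<open>
  A vertex outside the clique gets the color of a clique vertex missing it. As adjacent vertices
  have no common neighbour in the clique, it suffices to separate those missing both a and b from
  the others.
\<close>

theorem colorable_clique_number:
  assumes no_2K2: "\<not> has_induced_matching 2 S" and max: "maximum_clique K S"
    and free: "clique_minus_edge_free k S" and k: "2 \<le> k" "2 * k - 1 \<le> card K"
  shows "colorable S (card K)"
proof -
  note clique = maximum_cliqueD[OF max]
  obtain a b where ab: "a \<in> K" "b \<in> K" "a \<noteq> b"
    using k clique(2) card_le_Suc0_iff_eq[of K] by fastforce
  then have "E a b" using pairwiseD(1)[OF clique(3)] by blast
  have "\<exists>z\<in>K - {b}. \<not> E u z" if u: "u \<in> S - K" for u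
  proof (rule ccontr)
    assume "\<not> ?thesis"
    then have "card (K - {b}) \<le> card (nbrs K u)" using clique(2) by (intro card_mono) auto
    then show False using card_nbrs_maximum_clique[OF max free u] ab(2) clique(2) k by auto
  qed
  then obtain h where h: "\<And>u. u \<in> S - K \<Longrightarrow> h u \<in> K - {b} \<and> \<not> E u (h u)" by metis
  define c where
    "c u = (if u \<in> K then u else if E u a then h u else if E u b then a else b)" for u
  have misses_color: "c u \<in> K" "\<not> E u (c u)" if "u \<in> S - K" for u
    using h[OF that] ab that by (auto simp: c_def)
  have sees_a: "c u \<noteq> a \<and> c u \<noteq> b" if "u \<in> S - K" "E u a" for u
    using h[OF that(1)] that by (auto simp: c_def)
  have misses_a: "c u = (if E u b then a else b)" if "u \<in> S - K" "\<not> E u a" for u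
    using that by (simp add: c_def)
  have proper_outside: "c u \<noteq> c v" if uv: "u \<in> S - K" "v \<in> S - K" "E u v" for u v
  proof -
    have "\<not> (E u x \<and> E v x)" if "x \<in> K" for x
      using nbrs_of_edge_disjoint[OF no_2K2 max free k(2) uv] that by auto
    moreover have "E u a \<or> E u b \<or> E v a \<or> E v b"
      using edge_adjacent_to_edge[OF no_2K2 _ _ \<open>E a b\<close>] ab clique(1) uv by blast
    ultimately show ?thesis using ab sees_a misses_a uv(1,2) by metis
  qed
  show ?thesis
  proof (rule colorableI)
    show "c u \<in> K" if "u \<in> S" for u
      using misses_color(1) that by (cases "u \<in> K") (auto simp: c_def)
    show "c u \<noteq> c v" if uv: "u \<in> S" "v \<in> S" "E u v" for u v
    proof (cases "u \<in> K \<or> v \<in> K")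
      case True
      then show ?thesis
        using misses_color(2)[of u] misses_color(2)[of v] uv adj_irrefl adj_sym[OF uv(3)]
        by (auto simp: c_def)
    qed (use proper_outside uv in blast)
  qed (use clique(2) in simp_all)
qed

lemma colorable_6_K5_minus_e_free:
  assumes no_2K2: "\<not> has_induced_matching 2 S" and free: "clique_minus_edge_free 3 S"
    and max: "maximum_clique K S" "card K = 4"
  shows "colorable S 6"
proof -
  note clique = maximum_cliqueD[OF max(1)]
  obtain a b c d where abcd: "K = {a, b, c, d}" "distinct [a, b, c, d]"
    using max(2) by (auto simp: card_Suc_eq numeral_eq_Suc)
  have pair_colorable: "colorable (missing S x y) 1" "colorable (insert x (missing S x y)) 1"
    if "x \<in> K" "y \<in> K" "x \<noteq> y" for x y
  proof -
    have "x \<in> S" "y \<in> S" "E x y" using clique(1,3) that by (auto simp: pairwise_def)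
    then show "colorable (missing S x y) 1"
      by (intro colorable_stable stable_missing[OF no_2K2])
    then show "colorable (insert x (missing S x y)) 1"
      by (rule colorable_insert_isolated) auto
  qed
  let ?U = "insert a (missing S a b) \<union> insert b (missing S b c) \<union>
    (insert c (missing S c d) \<union> insert d (missing S d a)) \<union> (missing S a c \<union> missing S b d)"
  have cover: "v \<in> ?U" if v: "v \<in> S" for v
  proof (cases "v \<in> K")
    case False
    then have "card (nbrs K v) < 3" using card_nbrs_maximum_clique[OF max(1) free] v by blast
    then have "\<not> card (K - nbrs K v) \<le> Suc 0"
      using diff_card_le_card_Diff[of "nbrs K v" K] clique(2) max(2) by simp
    then obtain x y where xy: "x \<in> K - nbrs K v" "y \<in> K - nbrs K v" "x \<noteq> y"
      using card_le_Suc0_iff_eq[of "K - nbrs K v"] clique(2) by blast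
    then have "v \<in> missing S x y" using v by (simp add: adj_commute[of _ v])
    then show ?thesis using xy abcd by auto
  qed (use abcd in auto)
  have "colorable ?U (1 + 1 + (1 + 1) + (1 + 1))"
    using abcd by (intro colorable_Un pair_colorable) auto
  from colorable_mono[OF this subsetI[OF cover]] show ?thesis by simp
qed

lemma colorable_3_triangle_free_2K2_free:
  assumes "\<not> has_clique 3 S" "\<not> has_induced_matching 2 S"
  shows "colorable S 3"
proof (cases "has_clique 2 S")
  case True
  then obtain x y where xy: "x \<in> S" "y \<in> S" "E x y" unfolding has_clique_2_iff by blast
  have "colorable S (1 + 2 * 1)"
    using xy assms
    by (intro colorable_edge_partition[of S x y] colorable_stable stable_missing stable_nbrs)
  then show ?thesis by (simp add: numeral_3_eq_3)
next
  case False
  then show ?thesis using colorable_mono[OF colorable_1] by simp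
qed

definition five_cycle :: "'a set \<Rightarrow> 'a \<Rightarrow> 'a \<Rightarrow> 'a \<Rightarrow> 'a \<Rightarrow> 'a \<Rightarrow> bool" where
  "five_cycle S a b c d e \<longleftrightarrow> {a, b, c, d, e} \<subseteq> S \<and> E a b \<and> E b c \<and> E c d \<and> E d e \<and> E e a \<and>
     \<not> E a c \<and> \<not> E b d \<and> \<not> E c e \<and> \<not> E d a \<and> \<not> E e b"

lemma five_cycle_rotate: "five_cycle S a b c d e \<Longrightarrow> five_cycle S b c d e a"
  by (simp add: five_cycle_def)

lemma five_cycle_mono: "five_cycle S a b c d e \<Longrightarrow> S \<subseteq> T \<Longrightarrow> five_cycle T a b c d e"
  by (auto simp: five_cycle_def)

lemma colorable_2_or_five_cycle:
  assumes no_triangle: "\<not> has_clique 3 S" and no_2K2: "\<not> has_induced_matching 2 S"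
  obtains "colorable S 2"
  | a b c d e where "five_cycle S a b c d e"
proof (cases "has_clique 2 S")
  case False
  then show ?thesis using that(1) colorable_mono[OF colorable_1] by fastforce
next
  case True
  then obtain x y where xy: "x \<in> S" "y \<in> S" "E x y" unfolding has_clique_2_iff by blast
  let ?A = "missing S x y"
  let ?R = "{v \<in> ?A. \<exists>u\<in>nbrs S x. E v u}"
  have stable_parts: "stable (nbrs S x)" "stable (nbrs S y)" "stable ?A"
    using stable_nbrs[OF no_triangle] stable_missing[OF no_2K2] xy by auto
  show ?thesis
  proof (cases "\<exists>v\<in>?R. \<exists>w\<in>nbrs S y. E v w")
    case True
    then obtain v w u where v: "v \<in> ?A" and w: "w \<in> nbrs S y" "E v w" and u: "u \<in> nbrs S x" "E v u"
      by blast
    have "five_cycle S v u x y w"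
      using v w u xy adj_sym stableD[OF stable_parts(1), of u y] stableD[OF stable_parts(2), of x w]
        stableD[OF stable_nbrs[OF no_triangle, of v], of w u]
      by (auto simp: five_cycle_def)
    then show ?thesis by (rule that(2))
  next
    case False
    have "stable (nbrs S x \<union> (?A - ?R))" "stable (nbrs S y \<union> ?R)"
      using stable_parts False adj_sym stable_mono[OF stable_parts(3), of "?A - ?R"]
        stable_mono[OF stable_parts(3), of ?R]
      by (blast intro: stable_Un)+
    from colorable_Un[OF this[THEN colorable_stable]] have "colorable S 2"
      by (rule colorable_mono) auto
    then show ?thesis by (rule that(1))
  qed
qed

end

section \<open>Excluding induced subgraphs of critical graphs\<close>

text \<open>
  A pattern lists the vertices of a small graph, the latest one first; the row of a vertex says to
  which of the earlier vertices (again the latest first) it is adjacent.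
\<close>

type_synonym row = "bool list"
type_synonym pattern = "row list"

definition graph_pattern :: "nat list list \<Rightarrow> pattern" where
  "graph_pattern ns =
     rev (map (\<lambda>(k, l). map (\<lambda>j. j \<in> set l) (rev [0..<k])) (zip [0..<length ns] ns))"

fun adjacency_rows :: "pattern \<Rightarrow> row list" where
  "adjacency_rows [] = []"
| "adjacency_rows (r # p) = (False # r) # map2 (#) r (adjacency_rows p)"

fun subpattern :: "row list \<Rightarrow> nat list \<Rightarrow> pattern" where
  "subpattern R [] = []"
| "subpattern R (j # js) = map ((!) (R ! j)) js # subpattern R js"

definition select :: "bool list \<Rightarrow> 'b list \<Rightarrow> 'b list" where
  "select m xs = map snd (filter fst (zip m xs))"

text \<open>
  Each vertex of the pattern comes with a mask, the rows that it may still be mapped to; choosing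
  the row of one vertex narrows the masks of the others.
\<close>

fun embeds :: "row list \<Rightarrow> bool list list \<Rightarrow> pattern \<Rightarrow> bool" where
  "embeds R [] [] \<longleftrightarrow> True"
| "embeds R (m # ms) (r # q) \<longleftrightarrow> length r = length ms \<and>
     list_ex (\<lambda>t. embeds R (map2 (\<lambda>m b. map2 (\<lambda>a c. a \<and> c = b) m t) ms r) q) (select m R)"
| "embeds R _ _ \<longleftrightarrow> False"

text \<open>
  The first two vertices of a pattern are mapped to new vertices with rows r and s which are
  adjacent iff b, the others to the vertices with rows R.
\<close>

fun embeds_pair :: "row list \<Rightarrow> bool \<Rightarrow> row \<Rightarrow> row \<Rightarrow> pattern \<Rightarrow> bool" where
  "embeds_pair R b r s ((c # q1) # q2 # q) \<longleftrightarrow> length q1 = length q2 \<and> c = b \<and>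
     embeds R (map2 (\<lambda>x y. map2 (\<lambda>a d. a = x \<and> d = y) r s) q1 q2) q"
| "embeds_pair R b r s _ \<longleftrightarrow> False"

definition creates :: "pattern list \<Rightarrow> row list \<Rightarrow> bool \<Rightarrow> row \<Rightarrow> row \<Rightarrow> bool" where
  "creates F R b r s \<longleftrightarrow> list_ex (embeds_pair R b r s) F"

definition extend_rows :: "pattern list \<Rightarrow> row list \<Rightarrow> row \<Rightarrow> row list \<Rightarrow> row list" where
  "extend_rows F R q rs = [b # r. r \<leftarrow> rs, b \<leftarrow> [True, False], \<not> creates F R b r q]"

fun possible_rows :: "pattern list \<Rightarrow> pattern \<Rightarrow> row list" where
  "possible_rows F [] = [[]]"
| "possible_rows F (q # p) = extend_rows F (adjacency_rows p) q (possible_rows F p)"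

text \<open>
  A witness (k, js) points to the k-th pattern excluded so far and to the positions, counted from
  the latest vertex, where it occurs in the pattern at hand.
\<close>

type_synonym witness = "nat \<times> nat list"

definition contains :: "pattern list \<Rightarrow> pattern \<Rightarrow> witness \<Rightarrow> bool" where
  "contains known p = (\<lambda>(k, js). k < length known \<and> distinct js \<and>
     list_all (\<lambda>j. j < length p) js \<and> subpattern (adjacency_rows p) js = known ! k)"

datatype row_label = Color nat | Excluded nat "nat list"

definition colored_rows :: "row list \<Rightarrow> row_label list \<Rightarrow> (row \<times> nat) list" where
  "colored_rows rs ls = [(r, c). (r, Color c) \<leftarrow> zip rs ls]"

fun pairs :: "'b list \<Rightarrow> ('b \<times> 'b) list" where
  "pairs [] = []"
| "pairs (x # xs) = map (Pair x) (x # xs) @ pairs xs"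

definition conflicts :: "pattern list \<Rightarrow> row list \<Rightarrow> (row \<times> nat) list \<Rightarrow> (row \<times> row) list" where
  "conflicts F R rcs = [(r, s). ((r, c), (s, d)) \<leftarrow> pairs rcs, c = d, \<not> creates F R True r s]"

text \<open>
  A possible row may be that of a pattern vertex, which then does not extend the pattern; hence the
  comparisons with R in the next two definitions.
\<close>

fun valid_label :: "nat \<Rightarrow> pattern list \<Rightarrow> pattern \<Rightarrow> row list \<Rightarrow> row \<Rightarrow> row_label \<Rightarrow> bool" where
  "valid_label k known p R r (Color c) \<longleftrightarrow> c < k"
| "valid_label k known p R r (Excluded i js) \<longleftrightarrow> r \<notin> set R \<and> contains known (r # p) (i, js)"

definition valid_coloring :: "nat \<Rightarrow> pattern list \<Rightarrow> pattern list \<Rightarrow> pattern \<Rightarrow>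
    row list \<Rightarrow> row list \<Rightarrow> row_label list \<Rightarrow> witness list \<Rightarrow> bool" where
  "valid_coloring k F known p R rs ls ws \<longleftrightarrow>
     list_all2 (valid_label k known p R) rs ls \<and>
     list_all2 (\<lambda>(r, s) w. r \<notin> set (select s R) \<and> s \<notin> set (select r R) \<and>
         contains known ((True # s) # r # p) w)
       (conflicts F R (colored_rows rs ls)) ws"

definition valid_domination :: "pattern list \<Rightarrow> pattern \<Rightarrow>
    row list \<Rightarrow> row list \<Rightarrow> nat \<Rightarrow> nat \<Rightarrow> witness list \<Rightarrow> bool" where
  "valid_domination known p R rs i j ws \<longleftrightarrow>
     i < length p \<and> j < length p \<and> i \<noteq> j \<and> \<not> R ! i ! j \<and> list_all2 (\<longrightarrow>) (R ! i) (R ! j) \<and>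
     list_all2 (\<lambda>r. contains known (r # p)) (filter (\<lambda>r. r ! i \<and> \<not> r ! j) rs) ws"

datatype justification = Coloring "row_label list" "witness list" | Dominated nat nat "witness list"

fun justified :: "nat \<Rightarrow> pattern list \<Rightarrow> pattern list \<Rightarrow> pattern \<Rightarrow> justification \<Rightarrow> bool" where
  "justified k F known p (Coloring ls ws) \<longleftrightarrow>
     valid_coloring k F known p (adjacency_rows p) (possible_rows F p) ls ws"
| "justified k F known p (Dominated i j ws) \<longleftrightarrow>
     valid_domination known p (adjacency_rows p) (possible_rows F p) i j ws"

fun refutes :: "nat \<Rightarrow> pattern list \<Rightarrow> pattern list \<Rightarrow> (pattern \<times> justification) list \<Rightarrow> bool" where
  "refutes k F known [] \<longleftrightarrow> True"
| "refutes k F known ((p, J) # steps) \<longleftrightarrow>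
     justified k F known p J \<and> refutes k F (known @ [p]) steps"

lemma set_select_map: "set (select (map P vs) (map f vs)) = f ` {v \<in> set vs. P v}"
  by (induction vs) (auto simp: select_def)

lemma pairs_total: "x \<in> set xs \<Longrightarrow> y \<in> set xs \<Longrightarrow> (x, y) \<in> set (pairs xs) \<or> (y, x) \<in> set (pairs xs)"
  by (induction xs) auto

lemma list_all2_in_set_left: "list_all2 P xs ys \<Longrightarrow> x \<in> set xs \<Longrightarrow> \<exists>y\<in>set ys. P x y"
  by (induction rule: list_all2_induct) auto

context simple_graph begin

fun matches :: "pattern \<Rightarrow> 'a list \<Rightarrow> bool" where
  "matches [] vs \<longleftrightarrow> vs = []"
| "matches (r # p) [] \<longleftrightarrow> False"
| "matches (r # p) (v # vs) \<longleftrightarrow> map (E v) vs = r \<and> matches p vs"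

definition induced_copy :: "'a set \<Rightarrow> pattern \<Rightarrow> 'a list \<Rightarrow> bool" where
  "induced_copy S p vs \<longleftrightarrow> matches p vs \<and> distinct vs \<and> set vs \<subseteq> S"

definition occurs :: "'a set \<Rightarrow> pattern \<Rightarrow> bool" where
  "occurs S p \<longleftrightarrow> (\<exists>vs. induced_copy S p vs)"

lemma induced_copyD:
  assumes "induced_copy S p vs"
  shows "matches p vs" "distinct vs" "set vs \<subseteq> S"
  using assms by (auto simp: induced_copy_def)

lemma induced_copy_Cons:
  "induced_copy S p vs \<Longrightarrow> v \<in> S \<Longrightarrow> v \<notin> set vs \<Longrightarrow> induced_copy S (map (E v) vs # p) (v # vs)"
  by (simp add: induced_copy_def)

lemma matches_length: "matches p vs \<Longrightarrow> length vs = length p"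
  by (induction p vs rule: matches.induct) auto

lemma adjacency_rows_matches: "matches p vs \<Longrightarrow> adjacency_rows p = map (\<lambda>v. map (E v) vs) vs"
proof (induction p vs rule: matches.induct)
  case (3 r p v vs)
  have "r = map (\<lambda>x. E x v) vs" using 3(2) by (auto simp: adj_commute[of v])
  then show ?case using 3 by (simp add: adj_irrefl map2_map_map)
qed auto

lemma matches_subpattern:
  assumes "matches p vs" "list_all (\<lambda>j. j < length p) js"
  shows "matches (subpattern (adjacency_rows p) js) (map ((!) vs) js)"
  using assms(2)
proof (induction js)
  case (Cons j js)
  then show ?case
    using matches_length[OF assms(1)]
    by (auto simp: adjacency_rows_matches[OF assms(1)] list_all_iff)
qed simp

lemma contains_occurs:
  assumes "contains known p (k, js)" "induced_copy S p vs"
  shows "occurs S (known ! k)"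
proof -
  note vs = induced_copyD[OF assms(2)]
  have js: "distinct js" "list_all (\<lambda>j. j < length vs) js"
    and q: "known ! k = subpattern (adjacency_rows p) js"
    using assms(1) matches_length[OF vs(1)] by (auto simp: contains_def)
  have "matches (known ! k) (map ((!) vs) js)"
    unfolding q using matches_subpattern[OF vs(1)] js(2) matches_length[OF vs(1)] by simp
  moreover have "distinct (map ((!) vs) js)"
    using js vs(2) by (auto simp: distinct_map list_all_iff intro: inj_on_nth)
  moreover have "set (map ((!) vs) js) \<subseteq> S"
    using js(2) vs(3) by (auto simp: list_all_iff)
  ultimately show ?thesis unfolding occurs_def induced_copy_def by blast
qed

lemma embeds_matches:
  assumes "embeds (map (\<lambda>v. map (E v) vs) vs) (map (\<lambda>P. map P vs) Ps) q"
  obtains xs where "matches q xs" "list_all2 (\<lambda>P x. x \<in> set vs \<and> P x) Ps xs"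
  using assms
proof (induction q arbitrary: Ps thesis)
  case Nil
  then show ?case by (cases Ps) auto
next
  case (Cons r q)
  let ?R = "map (\<lambda>v. map (E v) vs) vs"
  from Cons.prems(2) obtain P Qs where Ps: "Ps = P # Qs" and len: "length r = length Qs"
    by (cases Ps) auto
  define Ps' where "Ps' v = map2 (\<lambda>Q b x. Q x \<and> E v x = b) Qs r" for v
  have masks: "map2 (\<lambda>m b. map2 (\<lambda>a c. a \<and> c = b) m (map (E v) vs)) (map (\<lambda>P. map P vs) Qs) r
      = map (\<lambda>P. map P vs) (Ps' v)" for v
    by (rule nth_equalityI) (simp_all add: Ps'_def map2_map_map)
  from Cons.prems(2) obtain v where v: "v \<in> set vs" "P v" and
    emb: "embeds ?R (map (\<lambda>P. map P vs) (Ps' v)) q"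
    by (auto simp: Ps list_ex_iff set_select_map masks)
  obtain xs where xs: "matches q xs" "list_all2 (\<lambda>P x. x \<in> set vs \<and> P x) (Ps' v) xs"
    using Cons.IH[OF _ emb] by blast
  have "length xs = length Qs" using list_all2_lengthD[OF xs(2)] len by (simp add: Ps'_def)
  then have "map (E v) xs = r" "list_all2 (\<lambda>P x. x \<in> set vs \<and> P x) Qs xs"
    using xs(2) len by (auto simp: Ps'_def list_all2_conv_all_nth intro: nth_equalityI)
  then show ?case
    using Cons.prems(1)[of "v # xs"] v xs(1) by (simp add: Ps)
qed

lemma embeds_pair_matches:
  assumes "embeds_pair (map (\<lambda>v. map (E v) vs) vs) (E u w) (map (E u) vs) (map (E w) vs) f"
  obtains xs where "matches f (u # w # xs)" "set xs \<subseteq> set vs"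
proof -
  obtain f1 f2 q where f: "f = (E u w # f1) # f2 # q" and len: "length f1 = length f2"
    and emb: "embeds (map (\<lambda>v. map (E v) vs) vs)
      (map2 (\<lambda>x y. map2 (\<lambda>a d. a = x \<and> d = y) (map (E u) vs) (map (E w) vs)) f1 f2) q"
    using assms by (elim embeds_pair.elims) auto
  define Ps where "Ps = map2 (\<lambda>b c x. E u x = b \<and> E w x = c) f1 f2"
  have "map2 (\<lambda>x y. map2 (\<lambda>a d. a = x \<and> d = y) (map (E u) vs) (map (E w) vs)) f1 f2 =
      map (\<lambda>P. map P vs) Ps"
    by (rule nth_equalityI) (simp_all add: Ps_def map2_map_map)
  from emb[unfolded this] obtain xs
    where xs: "matches q xs" "list_all2 (\<lambda>P x. x \<in> set vs \<and> P x) Ps xs"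
    by (rule embeds_matches)
  have "length xs = length f1" using list_all2_lengthD[OF xs(2)] len by (simp add: Ps_def)
  then have "map (E u) xs = f1" "map (E w) xs = f2" "set xs \<subseteq> set vs"
    using xs(2) len
    by (auto simp: Ps_def list_all2_conv_all_nth in_set_conv_nth intro: nth_equalityI)
  then show ?thesis using that[of xs] xs(1) by (simp add: f)
qed

end

locale refutation = simple_graph E for E :: "'a \<Rightarrow> 'a \<Rightarrow> bool" +
  fixes S :: "'a set" and k :: nat and F :: "pattern list"
  assumes crit: "critical S k"
    and F_free: "f \<in> set F \<Longrightarrow> matches f vs \<Longrightarrow> \<not> set vs \<subseteq> S"
begin

lemma not_creates:
  assumes "induced_copy S p vs" "u \<in> S" "w \<in> S"
  shows "\<not> creates F (adjacency_rows p) (E u w) (map (E u) vs) (map (E w) vs)"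
proof
  note vs = induced_copyD[OF assms(1)]
  assume "creates F (adjacency_rows p) (E u w) (map (E u) vs) (map (E w) vs)"
  then obtain f where "f \<in> set F"
    and "embeds_pair (map (\<lambda>v. map (E v) vs) vs) (E u w) (map (E u) vs) (map (E w) vs) f"
    by (auto simp: creates_def list_ex_iff adjacency_rows_matches[OF vs(1)])
  from this(1) embeds_pair_matches[OF this(2)]
  obtain xs where f: "f \<in> set F" "matches f (u # w # xs)" and "set xs \<subseteq> set vs" by blast
  then have "set (u # w # xs) \<subseteq> S" using assms(2,3) vs(3) by auto
  then show False using F_free[OF f] by blast
qed

lemma possible_rows_complete:
  "induced_copy S p vs \<Longrightarrow> w \<in> S \<Longrightarrow> map (E w) vs \<in> set (possible_rows F p)"
proof (induction p arbitrary: vs)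
  case Nil
  then show ?case by (simp add: induced_copy_def)
next
  case (Cons r p)
  then obtain v us where vs: "vs = v # us" "map (E v) us = r" "induced_copy S p us" "v \<in> S"
    by (cases vs) (auto simp: induced_copy_def)
  have "\<not> creates F (adjacency_rows p) (E w v) (map (E w) us) r"
    using not_creates[OF vs(3) Cons.prems(2) vs(4)] vs(2) by simp
  then show ?case
    using Cons.IH[OF vs(3) Cons.prems(2)]
    by (cases "E w v") (auto simp: vs(1) extend_rows_def)
qed

definition excluded :: "pattern list \<Rightarrow> bool" where
  "excluded known \<longleftrightarrow> (\<forall>q\<in>set known. \<not> occurs S q)"

lemma contains_excluded:
  "\<lbrakk>excluded known; contains known p w\<rbrakk> \<Longrightarrow> \<not> induced_copy S p vs"
  using contains_occurs[of known p "fst w" "snd w" S vs] by (auto simp: excluded_def contains_def)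

lemma valid_domination_sound:
  assumes known: "excluded known"
    and valid: "valid_domination known p (adjacency_rows p) (possible_rows F p) i j ws"
  shows "\<not> occurs S p"
proof
  assume "occurs S p"
  then obtain vs where copy: "induced_copy S p vs" by (auto simp: occurs_def)
  note vs = induced_copyD[OF copy]
  have ij: "i < length vs" "j < length vs" "i \<noteq> j" "\<not> E (vs ! i) (vs ! j)"
    and sub: "\<And>x. x \<in> set vs \<Longrightarrow> E (vs ! i) x \<Longrightarrow> E (vs ! j) x"
    and ws: "list_all2 (\<lambda>r. contains known (r # p))
      (filter (\<lambda>r. r ! i \<and> \<not> r ! j) (possible_rows F p)) ws"
    using valid matches_length[OF vs(1)]
    by (auto simp: valid_domination_def adjacency_rows_matches[OF vs(1)] list_all2_conv_all_nth
        in_set_conv_nth)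
  have "vs ! i \<noteq> vs ! j" using ij vs(2) by (simp add: nth_eq_iff_index_eq)
  moreover have "vs ! i \<in> S" "vs ! j \<in> S" using ij(1,2) vs(3) nth_mem by blast+
  ultimately obtain x where x: "x \<in> S" "E (vs ! i) x" "\<not> E (vs ! j) x"
    using critical_nbrs_not_subset[OF crit] ij(4) by (meson mem_nbrs subsetI)
  let ?r = "map (E x) vs"
  have "?r ! i \<and> \<not> ?r ! j" using ij x adj_sym[of x "vs ! j"] adj_sym[OF x(2)] by auto
  then have "?r \<in> set (filter (\<lambda>r. r ! i \<and> \<not> r ! j) (possible_rows F p))"
    using possible_rows_complete[OF copy x(1)] by simp
  then obtain w where "contains known (?r # p) w" using list_all2_in_set_left[OF ws] by blast
  moreover have "x \<notin> set vs" using x sub by blast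
  ultimately show False using contains_excluded[OF known] induced_copy_Cons[OF copy x(1)] by blast
qed

lemma colored_row_exists:
  assumes known: "excluded known" and copy: "induced_copy S p vs"
    and labels: "list_all2 (valid_label k known p (adjacency_rows p)) (possible_rows F p) ls"
    and v: "v \<in> S"
  shows "\<exists>c<k. (map (E v) vs, c) \<in> set (colored_rows (possible_rows F p) ls)"
proof -
  let ?r = "map (E v) vs"
  obtain n where n: "n < length (possible_rows F p)" "possible_rows F p ! n = ?r"
    using possible_rows_complete[OF copy v] by (auto simp: in_set_conv_nth)
  then have zip: "(?r, ls ! n) \<in> set (zip (possible_rows F p) ls)"
    using list_all2_lengthD[OF labels] by (auto simp: in_set_zip)
  show ?thesis
  proof (cases "ls ! n")
    case (Color c)
    then have "c < k" using list_all2_nthD[OF labels n(1)] by simp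
    then show ?thesis using zip Color by (auto simp: colored_rows_def split: row_label.splits)
  next
    case (Excluded i js)
    then have "?r \<notin> set (adjacency_rows p)" "contains known (?r # p) (i, js)"
      using list_all2_nthD[OF labels n(1)] n(2) by auto
    moreover from this(1) have "v \<notin> set vs"
      by (auto simp: adjacency_rows_matches[OF induced_copyD(1)[OF copy]])
    ultimately show ?thesis
      using contains_excluded[OF known] induced_copy_Cons[OF copy v] by blast
  qed
qed

lemma conflict_excluded:
  assumes known: "excluded known" and copy: "induced_copy S p vs" and uw: "u \<in> S" "w \<in> S" "E u w"
    and new: "map (E u) vs \<notin> set (select (map (E w) vs) (adjacency_rows p))"
      "map (E w) vs \<notin> set (select (map (E u) vs) (adjacency_rows p))"
  shows "\<not> contains known ((True # map (E w) vs) # map (E u) vs # p) x"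
proof -
  have "u \<notin> set vs" "w \<notin> set vs"
    using new uw adj_sym[OF uw(3)]
    by (auto simp: adjacency_rows_matches[OF induced_copyD(1)[OF copy]] set_select_map)
  moreover have "w \<noteq> u" using uw adj_irrefl by blast
  ultimately have "induced_copy S (map (E w) (u # vs) # map (E u) vs # p) (w # u # vs)"
    using copy uw by (intro induced_copy_Cons) auto
  then have "induced_copy S ((True # map (E w) vs) # map (E u) vs # p) (w # u # vs)"
    using adj_sym[OF uw(3)] by simp
  then show ?thesis using contains_excluded[OF known] by blast
qed

lemma valid_coloring_sound:
  assumes known: "excluded known"
    and valid: "valid_coloring k F known p (adjacency_rows p) (possible_rows F p) ls ws"
  shows "\<not> occurs S p"
proof
  assume "occurs S p"
  then obtain vs where copy: "induced_copy S p vs" by (auto simp: occurs_def)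
  let ?row = "\<lambda>v. map (E v) vs" and ?C = "set (colored_rows (possible_rows F p) ls)"
  let ?conflicts = "set (conflicts F (adjacency_rows p) (colored_rows (possible_rows F p) ls))"
  have "\<forall>v\<in>S. \<exists>c<k. (?row v, c) \<in> ?C"
    using colored_row_exists[OF known copy] valid by (simp add: valid_coloring_def)
  then obtain c where c: "\<And>v. v \<in> S \<Longrightarrow> c v < k" "\<And>v. v \<in> S \<Longrightarrow> (?row v, c v) \<in> ?C" by metis
  have no_conflict: "(?row u, ?row w) \<notin> ?conflicts" if uw: "u \<in> S" "w \<in> S" "E u w" for u w
    using conflict_excluded[OF known copy uw] valid
    by (fastforce simp: valid_coloring_def dest: list_all2_in_set_left)
  have "colorable S k"
  proof (rule colorableI)
    show "c v \<in> {..<k}" if "v \<in> S" for v using c(1)[OF that] by simp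
    show "c u \<noteq> c w" if uw: "u \<in> S" "w \<in> S" "E u w" for u w
    proof
      assume eq: "c u = c w"
      note wu = uw(2,1) adj_sym[OF uw(3)]
      have "\<not> creates F (adjacency_rows p) True (?row u) (?row w)"
        "\<not> creates F (adjacency_rows p) True (?row w) (?row u)"
        using not_creates[OF copy uw(1,2)] not_creates[OF copy uw(2,1)] uw(3) wu(3) by simp_all
      then have "(?row u, ?row w) \<in> ?conflicts \<or> (?row w, ?row u) \<in> ?conflicts"
        using pairs_total[OF c(2)[OF uw(1)] c(2)[OF uw(2)]] eq by (force simp: conflicts_def)
      then show False using no_conflict[OF uw] no_conflict[OF wu] by blast
    qed
  qed simp_all
  then show False using crit unfolding critical_def by blast
qed

lemma refutes_known_sound:
  "\<lbrakk>refutes k F known steps; excluded known; p \<in> fst ` set steps\<rbrakk> \<Longrightarrow> \<not> occurs S p"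
proof (induction steps arbitrary: known)
  case (Cons step steps)
  obtain q K where step: "step = (q, K)" by (cases step)
  have q: "\<not> occurs S q"
    using Cons.prems(1,2) valid_coloring_sound valid_domination_sound
    by (cases K) (auto simp: step)
  then have "excluded (known @ [q])" using Cons.prems(2) by (auto simp: excluded_def)
  then show ?case using Cons.IH Cons.prems(1,3) q by (auto simp: step)
qed simp

theorem refutes_sound: "\<lbrakk>refutes k F [] steps; p \<in> fst ` set steps\<rbrakk> \<Longrightarrow> \<not> occurs S p"
  using refutes_known_sound[of "[]"] by (simp add: excluded_def)

end

section \<open>Two classes of 4-colorable graphs\<close>

definition five_cycle_plus :: "nat list list \<Rightarrow> pattern" where
  "five_cycle_plus ns = graph_pattern ([[], [0], [1], [2], [0,3]] @ ns)"

abbreviation (input) "five_wheel \<equiv> five_cycle_plus [[0,1,2,3,4]]"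
abbreviation (input) "five_cycle_and_vertex \<equiv> five_cycle_plus [[]]"
abbreviation (input) "five_cycle_edge_vertex \<equiv> five_cycle_plus [[], [5], []]"
abbreviation (input) "triangle_and_vertex \<equiv> graph_pattern [[], [0], [0,1], []]"

text \<open>
  The latest two vertices of a pattern are the ones to be completed; 2K2 and 3K2 are listed once
  with an edge and once with a non-edge there.
\<close>

definition K4_2K2 :: "pattern list" where
  "K4_2K2 =
    [graph_pattern [[], [0], [0,1], [0,1,2]],
     graph_pattern [[], [0], [], [2]], graph_pattern [[], [], [0], [1]]]"

definition K3_3K2 :: "pattern list" where
  "K3_3K2 =
    [graph_pattern [[], [0], [0,1]],
     graph_pattern [[], [0], [], [2], [], [4]], graph_pattern [[], [0], [], [], [2], [3]]]"

abbreviation (input) "c0 \<equiv> Color 0"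
abbreviation (input) "c1 \<equiv> Color 1"
abbreviation (input) "c2 \<equiv> Color 2"
abbreviation (input) "c3 \<equiv> Color 3"

definition K4_2K2_steps :: "(pattern \<times> justification) list" where
  "K4_2K2_steps = [
    (five_cycle_plus [[0,1,2,3], [0,1,2,3], [5]], Dominated 1 2 []),
    (five_cycle_plus [[0,1,2,3], []], Dominated 0 2 [(0, [1,2,0,3,4,5,6,7])]),
    (five_cycle_plus [[0,1,2,3], [0,2,4,5], [0,3]], Dominated 6 1 [(1, [1,6,4,0,7,3,2])]),
    (five_cycle_plus [[0,1,2,3], [0,1,2,3], [0,3,5]],
      Dominated 1 2 [(1, [4,6,1,0,2,7,3]), (1, [4,7,1,0,2,6,3])]),
    (five_cycle_plus [[0,1,2,3], [0,1,2,3], [0,2,5]], Dominated 0 6 [(3, [0,3,2,4,5,6,7,8])]),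
    (five_cycle_plus [[0,1,2,3], [0,1,2,3]],
      Dominated 1 0 [(4, [0,1,2,3,4,5,6,7]), (3, [0,1,2,3,4,5,6,7]), (4, [0,1,2,3,7,6,5,4]),
        (1, [0,1,3,4,5,6,7])]),
    (five_cycle_plus [[0,1,2,3], [0,2,5]],
      Dominated 5 0 [(5, [0,2,3,4,5,6,7]), (2, [3,6,2,0,4,5,1,7])]),
    (five_cycle_plus [[0,1,2,3], [0,3]],
      Dominated 2 0 [(5, [0,2,1,4,5,6,7]), (6, [0,2,1,4,5,6,7]), (6, [0,2,1,7,6,5,4])]),
    (five_cycle_plus [[0,1,2,3], [0,2,4,5], [1,2,3,4,6], [5,6,7]], Dominated 0 6 []),
    (five_cycle_plus [[0,1,2,3], [0,1,3], [1,4,5], [0,1,2,4]],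
      Coloring [c0, c0, c0, c0, c0, c1, c1, c3, c3, c1, c1, c1, c1, c2, c2, c2, c2, c2, c3, c3,
        c3, c1] []),
    (five_cycle_plus [[0,1,2,3], [0,1,3], [0,1,2,3,4], [0,3,5,6,7]],
      Coloring [c0, c0, c0, c0, c0, c0, c3, c1, c1, c0, c1, c1, c1, Excluded 5 [2,4,0,6,7,8,9],
        c3, Excluded 5 [3,4,5,6,0,8,9], c2, Excluded 5 [3,4,0,6,1,9,8], c2,
        Excluded 5 [2,3,0,6,1,9,8], c2, c2, c2, c3, c3, c1, c1, c1, c1] [(5, [1,4,8,7,2,0,9])]),
    (five_cycle_plus [[0,1,2,3], [0,2,4,5], [0,1,2,3,4], [0,1,2,3,4]],
      Coloring [c0, c0, c0, c0, c0, c3, c1, c1, c0, Excluded 6 [1,6,3,4,0,2,5], c1,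
        Excluded 6 [3,4,0,6,7,8,9], c0, c3, Excluded 7 [1,0,2,5,3,4,8], c2, c2, c2, c2,
        Excluded 6 [1,5,0,3,9,2,6], c2, Excluded 6 [1,0,3,4,8,2,5], c3, c3,
        Excluded 6 [1,6,0,4,7,2,5], c3, c3, c3, Excluded 6 [1,9,0,4,8,2,5], c1, c1,
        Excluded 6 [6,7,0,3,4,8,1], c0] [(7, [2,0,3,6,4,1,9]), (6, [2,6,1,0,7,3,10])]),
    (five_cycle_plus [[0,1,2,3], [0,2,4,5], [1,2,3,4,6]],
      Coloring [c1, c1, c2, c1, c1, c0, c0, c0, c2, c2, c2, c1, c3, c3, c3, c2, c1, c3, c3, c3,
        c0, c3, Excluded 8 [0,1,2,3,4,5,6,7,8], c0, c2, c1] [(8, [0,6,1,8,5,2,7,4,9]),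
        (8, [0,2,1,4,5,6,7,8,9]), (11, [1,2,9,4,5,0,8,7,3]), (11, [3,6,1,8,5,2,7,4,0]),
        (10, [1,3,0,6,9,5,2,7,4])]),
    (five_cycle_plus [[0,1,2,3], [1,2,4], [0,1,2,3,4]],
      Coloring [c0, c0, Excluded 12 [6,1,8,5,3,7,0,4], c0, c0, c3, c1, c1, c3, c1, c1,
        Excluded 5 [1,3,0,5,6,7,8], Excluded 12 [5,1,7,4,0,6,3,8], c3, c2, c2, c2, c2,
        Excluded 12 [0,1,6,4,2,7,3,5], c2, c2, Excluded 12 [0,1,7,4,2,6,3,8], c3, c3, c1, c1,
        c1] [(12, [0,2,8,5,1,7,4,9])]),
    (five_cycle_plus [[0,1,2,3], [0,2,4,5], [0,1,2,3,4]],
      Coloring [c0, c0, Excluded 12 [6,1,8,5,3,7,0,4], c0, c0, c2, c2, c3, c0, c3, c3, c0,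
        Excluded 12 [0,2,3,4,5,6,7,8], Excluded 13 [1,0,3,4,5,6,7,8],
        Excluded 12 [0,5,6,4,2,3,7,1], c1, c1, c0, c1, Excluded 12 [1,8,3,4,0,7,6,2],
        Excluded 13 [8,0,6,4,1,7,3,2], c2, c2, c1, c1, c1, c0] [(13, [1,3,2,0,6,5,9,8])]),
    (five_cycle_plus [[0,1,2,3], [0,2,4,5], [5,6]],
      Dominated 0 7 [(12, [0,2,3,4,5,6,7,8]), (13, [2,5,7,4,0,6,3,8]),
        (9, [7,1,5,2,0,4,8,3,6])]),
    (five_cycle_plus [[0,1,2,3], [0,3,5], [0,1,2,3,4,6]],
      Dominated 3 1 [(14, [1,0,3,4,5,6,7,8]), (14, [1,0,3,4,8,7,6,5])]),
    (five_cycle_plus [[0,1,2,3], [1,2,4]],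
      Coloring [c1, c1, c1, c0, c0, c3, c3, c3, c1, c0, c0, c1, c1, c2, c2, c2, c1, c2, c2, c3,
        c3, c2, c0] [(15, [0,1,6,4,2,7,3,5]), (15, [0,1,7,4,2,6,3,8]), (15, [0,1,7,4,2,6,3,8]),
        (14, [6,8,1,3,5,0,2,7]), (14, [3,2,1,6,5,0,8,7]), (14, [3,2,1,7,8,0,5,6]),
        (15, [1,0,6,4,2,7,3,5]), (15, [0,1,3,4,8,7,6,5]), (15, [0,1,3,4,8,7,6,5])]),
    (five_cycle_plus [[0,1,2,3], [0,2,4,5]],
      Coloring [Excluded 14 [0,1,2,3,4,5,6,7], c2, c2, c2, c3, c3, c0, c0, c3, c3, c3, c3,
        Excluded 6 [1,2,0,4,5,6,7], c2, Excluded 17 [0,2,3,4,5,6,7],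
        Excluded 17 [0,2,3,4,5,6,7], c1, c1, c2, c1, c1, c0, Excluded 15 [0,1,2,3,4,5,6,7], c0,
        c2, c3] [(6, [0,1,4,8,7,6,5]), (15, [0,2,1,4,5,6,7,8]), (17, [0,8,5,3,7,1,4]),
        (16, [2,1,7,4,0,6,3,8]), (16, [3,2,1,7,6,5,0,8]), (15, [0,1,3,4,5,6,7,8]),
        (17, [0,2,5,4,8,1,6])]),
    (five_cycle_plus [[0,1,2,3], [0,1,2,3,4]],
      Dominated 1 0 [(18, [0,2,3,4,5,6,7]), (18, [0,2,3,7,6,5,4]), (18, [7,6,3,0,2,5,1]),
        (18, [4,5,3,0,2,6,1])]),
    (five_cycle_plus [[0,1,2,3]],
      Coloring [Excluded 19 [0,1,2,3,4,5,6], c2, c2, c2, c1, Excluded 18 [0,1,2,3,4,5,6], c1,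
        c1, c3, c1, c2, c0, Excluded 18 [0,1,2,6,5,4,3], c3, c2, c0, c0, c3, c0]
        [(6, [0,1,3,7,6,5,4]), (18, [5,6,4,0,1,7,2]), (18, [1,0,7,3,4,5,6]),
        (5, [1,2,3,4,5,0,7]), (18, [1,2,0,4,5,6,7]), (18, [0,6,3,7,2,5,1]),
        (18, [0,5,3,4,2,6,1]), (18, [0,2,3,4,5,6,1])]),
    (five_wheel,
      Coloring [c0, Excluded 20 [0,2,3,4,5,6], Excluded 20 [0,3,2,6,5,4],
        Excluded 20 [0,4,3,2,6,5], c2, Excluded 20 [0,5,4,3,2,6], c1, c0, c1,
        Excluded 20 [1,0,4,3,2,6], c1, Excluded 20 [1,0,3,4,5,6], Excluded 20 [0,6,2,3,4,5], c0,
        c2, c2, Excluded 20 [1,0,3,2,6,5], c3, Excluded 20 [1,0,2,3,4,5], c3,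
        Excluded 20 [1,0,2,6,5,4], c3, c1] [(20, [1,3,4,0,6,7]), (20, [1,3,4,5,0,7]),
        (20, [1,6,5,4,0,7]), (20, [1,7,3,4,0,6])]),
    (five_cycle_plus [[0,1,3], [0,1,3], [5]],
      Dominated 1 2 [(20, [8,1,0,2,7,3]), (20, [7,1,0,2,8,3])]),
    (five_cycle_plus [[0,1,3], []],
      Dominated 0 1 [(21, [0,3,4,5,6,7]), (20, [0,3,4,5,6,7]), (20, [0,5,4,3,7,6]),
        (22, [1,2,0,3,4,5,6,7])]),
    (five_cycle_plus [[0,1,3], [5]],
      Coloring [c3, Excluded 20 [0,3,4,5,6,7], Excluded 20 [0,4,3,7,6,5],
        Excluded 20 [0,5,4,3,7,6], c0, Excluded 23 [1,0,3,4,5,6,7], Excluded 20 [0,6,5,4,3,7],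
        Excluded 20 [0,6,5,4,3,7], c2, Excluded 23 [1,0,3,7,6,5,4], c2, c2,
        Excluded 23 [1,0,4,5,6,7,3], c2, Excluded 20 [2,5,4,0,7,6], c0,
        Excluded 20 [0,7,3,4,5,6], Excluded 20 [0,7,3,4,5,6], c3, Excluded 23 [1,0,4,3,7,6,5],
        c3, Excluded 23 [1,0,5,6,7,3,4], c3, Excluded 20 [2,3,4,0,6,7], c0, c1, c1, c1,
        Excluded 23 [0,2,3,4,5,6,7]] [(20, [1,6,5,0,8,7]), (20, [1,4,5,0,7,8]),
        (20, [0,7,3,2,1,6]), (20, [1,4,5,6,0,8]), (20, [1,8,3,2,0,4]), (23, [2,0,5,6,7,1,4])]),
    (five_cycle_and_vertex,
      Dominated 0 5 [(20, [0,6,2,3,4,5]), (24, [1,0,3,2,6,5,4]), (24, [1,0,4,5,6,2,3])]),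
    (graph_pattern [[], [0], [0,1], [], [0,1,3]],
      Dominated 2 0 [(20, [5,2,0,3,4,1]), (20, [4,2,0,3,5,1])]),
    (triangle_and_vertex, Dominated 0 3 [(26, [0,1,4,2,3])])]"

definition K3_3K2_steps :: "(pattern \<times> justification) list" where
  "K3_3K2_steps = [
    (five_cycle_plus [[], [5], [], [0,2,5,7], [1,3,6,7]],
      Coloring [c1, c1, c1, c3, c3, c3, c1, c1, c2, c2, c3, c1, c1, c1, c3, c1, c2, c2, c2, c2,
        c2, c2, c0, c2, c0, c1, c2, c1, c1, c1, c0, c1, c3, c1, c2, c2, c2, c1, c0, c1, c1, c3,
        c2, c0, c0, c3, c3] []),
    (five_cycle_plus [[], [5], [], [0,2,5], [1,3,6,7]],
      Coloring [c1, c1, c1, c3, c0, c0, c1, c1, c3, c3, c3, c1, c1, c1, c3, c1, c2, c2, c2, c2,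
        c2, c3, c2, c2, c2, c2, c1, c2, c2, c1, c1, c1, c0, c1, c1, c2, c3, c2, c3, c1, c2, c2,
        c1, c1, c2, c2, c3, c0, c0, c0, c0] []),
    (five_cycle_plus [[], [5], [], [0,5], [1,3,6,7]],
      Coloring [c0, c0, c0, c1, c0, c0, c3, c3, c0, c0, c0, c3, c0, c2, c2, c2, c2, c2, c3, c0,
        c2, c2, c2, c2, c2, c0, c2, c2, c1, c1, c1, c0, c2, c0, c2, c2, c3, c0, c0, c2, c2, c0,
        c2, c2, c1, c1, c1, c1] []),
    (five_cycle_plus [[], [5], [], [5,7], [0,2,6,7]],
      Coloring [c0, c0, c1, c0, c2, c2, c0, c1, c1, c2, c0, c1, c2, c2, c2, c1, c1, c1, c2, c3,
        c3, c3, c1, c1, c1, c3, c3, c3, c0, c1, c1, c3, c0, c1, c2, c1, c3, c1, c0, c2, c0, c1,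
        c1, c0] []),
    (five_cycle_plus [[], [5], [], [0,2,5], [0,3,6,7]],
      Coloring [c0, c0, c1, c1, c3, c3, c3, c1, c3, c1, c3, c3, c2,
        Excluded 1 [0,2,3,4,5,6,7,8,9,10], c2, c2, c0, c2, c2, c2, c2,
        Excluded 2 [1,2,3,4,5,9,0,6,7,8], c3, c0, Excluded 2 [1,0,3,4,5,8,7,6,10,9], c2, c2,
        Excluded 0 [0,1,3,5,4,9,8,7,6,10], c0, Excluded 1 [1,0,3,4,5,9,10,6,7,8], c3, c0, c0,
        c0, Excluded 2 [1,0,3,4,5,9,10,6,7,8], c1, c3, c2, c3, c2, c3, c0, c2, c3, c3, c0, c2,
        c2, c1, c2, c2, c1, c1] [(1, [8,6,7,9,3,4,2,5,1,0]), (1, [8,6,7,9,3,4,2,5,1,0]),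
        (1, [8,6,7,9,3,4,2,5,0,1]), (0, [0,11,7,4,2,6,1,10,9,3]), (0, [1,11,10,6,3,4,0,7,8,2]),
        (1, [8,6,7,9,3,4,2,5,0,1]), (1, [8,6,7,9,3,4,2,5,1,0])]),
    (five_cycle_plus [[], [5], [], [0,2,5,7], [0,6,7]],
      Coloring [c1, c3, c1, c1, c3, c3, c2, c1, c3, Excluded 0 [0,10,9,7,6,4,5,2,3,1], c2, c2,
        Excluded 0 [0,2,3,4,5,6,7,8,9,10], c2, c2, c2, c2, c2, c2, c0,
        Excluded 0 [0,2,3,4,5,7,6,10,9,8], c0, c0, c0, c0, c0, c0, c0, c0, c0, c0, c0, c0, c1,
        c1, c3, c1, c2, c3, c2, c3, c0, c0, c1, c3, c3, c2, c1] [(0, [0,11,1,8,7,5,6,3,4,2]),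
        (0, [1,11,10,8,7,5,6,3,0,2]), (0, [1,3,0,5,6,7,8,9,10,11])]),
    (five_cycle_plus [[], [5], [], [5,7], [6,7]],
      Coloring [Excluded 3 [0,1,3,5,4,6,7,8,9,10], Excluded 3 [0,2,5,1,3,6,7,8,9,10],
        Excluded 3 [0,2,3,4,5,6,7,8,9,10], Excluded 3 [0,1,4,2,3,6,7,8,9,10],
        Excluded 3 [0,4,1,2,5,6,7,8,9,10], c0, Excluded 3 [0,1,3,5,4,8,9,10,6,7],
        Excluded 3 [0,2,5,1,3,8,9,10,6,7], Excluded 3 [0,2,3,4,5,8,9,10,6,7],
        Excluded 3 [0,1,4,2,3,8,9,10,6,7], Excluded 3 [0,4,1,2,5,8,9,10,6,7], c0,
        Excluded 3 [0,1,3,5,4,6,10,9,8,7], Excluded 3 [0,2,5,1,3,6,10,9,8,7],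
        Excluded 3 [0,2,3,4,5,6,10,9,8,7], Excluded 3 [0,1,4,2,3,6,10,9,8,7],
        Excluded 3 [0,4,1,2,5,6,10,9,8,7], c1, Excluded 3 [0,1,3,5,4,7,8,9,10,6],
        Excluded 3 [0,2,5,1,3,7,8,9,10,6], Excluded 3 [0,2,3,4,5,7,8,9,10,6],
        Excluded 3 [0,1,4,2,3,7,8,9,10,6], Excluded 3 [0,4,1,2,5,7,8,9,10,6], c1,
        Excluded 3 [0,1,3,5,4,9,10,6,7,8], Excluded 3 [0,2,5,1,3,9,10,6,7,8],
        Excluded 3 [0,2,3,4,5,9,10,6,7,8], Excluded 3 [0,1,4,2,3,9,10,6,7,8],
        Excluded 3 [0,4,1,2,5,9,10,6,7,8], c2, c0, c0, c1, c1, c2, c0] []),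
    (five_cycle_plus [[], [5], [], [5,7]],
      Dominated 2 0 [(3, [0,1,2,3,4,5,6,7,8,9]), (3, [0,1,2,3,4,7,8,9,5,6]),
        (3, [0,1,2,3,4,5,9,8,7,6]), (3, [0,1,2,3,4,6,7,8,9,5]), (3, [0,1,2,3,4,8,9,5,6,7]),
        (6, [0,1,2,3,4,5,6,7,8,9])]),
    (five_cycle_plus [[], [5], [], [0,5,7]],
      Coloring [c1, c1, Excluded 5 [1,0,2,4,3,5,6,7,8,9], c0, c1, c1,
        Excluded 5 [1,0,2,4,3,8,7,6,5,9], c3, c1, c1, Excluded 7 [6,5,8,7,0,2,1,4,3], c1, c1,
        c2, c2, c2, c3, c3, c1, c1, c2, c2, Excluded 7 [1,2,3,4,0,5,6,7,8], c1, c2, c1, c1, c2,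
        c2, c2, c0, c0, c1, c1, c2, c2, c1, c1, c2, c2, c1, c2, Excluded 7 [0,2,3,4,5,6,7,8,9],
        c1, c2, c0, c0] [(5, [2,0,3,5,4,6,7,8,9,1]), (5, [2,0,3,5,4,9,8,7,6,1])]),
    (five_cycle_plus [[], [5], [], [0,2,5,7]],
      Coloring [c2, c1, c1, c1, c2, c2, c2, Excluded 4 [1,0,2,4,3,8,7,6,5,9], c2,
        Excluded 8 [0,2,3,4,5,6,7,8,9], c2, Excluded 8 [0,2,4,3,5,6,7,8,9], c2, c2,
        Excluded 0 [0,1,2,3,4,5,6,7,8,9], c0, c0, c0, Excluded 8 [1,2,3,4,5,6,0,8,9], c3, c3,
        Excluded 0 [0,1,2,3,4,6,5,9,8,7], c0, c0, c0, Excluded 8 [1,2,3,4,6,5,0,8,7],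
        Excluded 8 [0,2,3,4,7,6,5,9,8], c0, c3, c3, c1, Excluded 4 [1,0,2,4,3,8,9,5,6,7], c1,
        Excluded 8 [0,2,3,4,6,5,9,8,7], c1, Excluded 8 [0,2,4,3,6,5,9,8,7],
        Excluded 8 [0,2,3,4,5,9,8,7,6], c2, Excluded 8 [0,2,4,3,5,9,8,7,6], c0, c0,
        Excluded 8 [0,2,3,4,6,7,8,9,5], c3, Excluded 8 [0,2,4,3,6,7,8,9,5], c0, c0, c1, c3,
        Excluded 8 [7,8,5,6,2,0,3,4,1], c0, c0, c1] [(8, [0,3,4,5,8,7,6,10,1]),
        (0, [1,2,0,4,5,6,7,8,9,10]), (4, [2,0,3,5,4,9,10,6,7,1]), (0, [1,2,0,4,5,7,6,10,9,8]),
        (4, [2,0,3,5,4,9,8,7,6,1]), (4, [1,2,0,4,5,7,6,10,9,8]), (8, [0,3,4,5,6,10,9,8,1]),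
        (8, [1,0,5,4,6,10,9,8,7]), (8, [1,0,5,4,7,8,9,10,6]), (8, [5,4,0,1,8,7,6,10,2])]),
    (five_cycle_edge_vertex,
      Dominated 0 7 [(9, [0,1,2,3,4,8,7,6,5]), (9, [0,1,3,2,4,8,7,6,5]),
        (9, [0,1,2,3,5,6,7,8,4]), (9, [0,1,3,2,5,6,7,8,4]), (8, [0,1,2,3,6,5,4,8,7]),
        (8, [0,1,3,2,6,5,4,8,7]), (9, [0,1,2,3,7,8,4,5,6]), (9, [0,1,3,2,7,8,4,5,6]),
        (8, [0,1,2,3,5,4,8,7,6]), (8, [0,1,3,2,5,4,8,7,6]), (8, [0,1,2,3,4,8,7,6,5]),
        (8, [0,1,3,2,4,8,7,6,5]), (8, [0,1,2,3,5,6,7,8,4]), (8, [0,1,3,2,5,6,7,8,4]),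
        (7, [0,1,2,3,4,5,6,7,8]), (7, [0,1,3,2,4,5,6,7,8])])]"

lemma K4_2K2_steps_refute: "refutes 4 K4_2K2 [] K4_2K2_steps"
  by code_simp

lemma K3_3K2_steps_refute: "refutes 4 K3_3K2 [] K3_3K2_steps"
  by code_simp

context simple_graph begin

lemma has_induced_matching_3I:
  assumes "a \<in> S" "b \<in> S" "E a b" "{c, d, x, y} \<subseteq> missing S a b" "E c d"
    and "{x, y} \<subseteq> missing S c d" "E x y"
  shows "has_induced_matching 3 S"
proof -
  have "x \<in> missing (missing S a b) c d" "y \<in> missing (missing S a b) c d" using assms(4,6) by auto
  then have "has_induced_matching 2 (missing S a b)"
    using assms(4,5,7) unfolding has_induced_matching_2_iff by blast
  then show ?thesis using assms(1-3) unfolding has_induced_matching_3_iff by blast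
qed

lemma matches_Cons_iff:
  "matches (r # p) vs \<longleftrightarrow> (\<exists>v us. vs = v # us \<and> map (E v) us = r \<and> matches p us)"
  by (cases vs) auto

lemma refutation_K4_2K2:
  assumes "critical S 4" "\<not> has_clique 4 S" "\<not> has_induced_matching 2 S"
  shows "refutation E S 4 K4_2K2"
proof unfold_locales
  fix f vs
  assume f: "f \<in> set K4_2K2" "matches f vs"
  then consider a b c d where "vs = [a, b, c, d]" "E a b" "E a c" "E b c" "E a d" "E b d" "E c d"
    | a b c d where "vs = [a, b, c, d]" "E a b" "E c d" "{c, d} \<subseteq> missing UNIV a b"
    | a b c d where "vs = [a, c, b, d]" "E a b" "E c d" "{c, d} \<subseteq> missing UNIV a b"
    using adjacency_rows_matches[OF f(2)]
    by (auto simp: K4_2K2_def graph_pattern_def matches_Cons_iff)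
  then show "\<not> set vs \<subseteq> S"
  proof cases
    case 1
    then show ?thesis using assms(2) unfolding has_clique_4_iff by simp blast
  next
    case (2 a b c d)
    then show ?thesis
      using assms(3) stable_missing[of S a b] stableD[of "missing S a b" c d] by auto
  next
    case (3 a b c d)
    then show ?thesis
      using assms(3) stable_missing[of S a b] stableD[of "missing S a b" c d] by auto
  qed
qed (use assms in auto)

lemma refutation_K3_3K2:
  assumes "critical S 4" "\<not> has_clique 3 S" "\<not> has_induced_matching 3 S"
  shows "refutation E S 4 K3_3K2"
proof unfold_locales
  fix f vs
  assume f: "f \<in> set K3_3K2" "matches f vs"
  then consider a b c where "vs = [a, b, c]" "E a b" "E a c" "E b c"
    | a b c d x y where "vs = [a, b, c, d, x, y]" "E a b" "E c d" "E x y"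
      "{c, d, x, y} \<subseteq> missing UNIV a b" "{x, y} \<subseteq> missing UNIV c d"
    | a b c d x y where "vs = [a, c, b, d, x, y]" "E a b" "E c d" "E x y"
      "{c, d, x, y} \<subseteq> missing UNIV a b" "{x, y} \<subseteq> missing UNIV c d"
    using adjacency_rows_matches[OF f(2)]
    by (auto simp: K3_3K2_def graph_pattern_def matches_Cons_iff)
  then show "\<not> set vs \<subseteq> S"
  proof cases
    case 1
    then show ?thesis using assms(2) unfolding has_clique_3_iff by simp blast
  next
    case (2 a b c d x y)
    then show ?thesis using assms(3) has_induced_matching_3I[of a S b c d x y] by auto
  next
    case (3 a b c d x y)
    then show ?thesis using assms(3) has_induced_matching_3I[of a S b c d x y] by auto
  qed
qed (use assms in auto)

lemma pattern_rows:
  "five_wheel = replicate 5 True # five_cycle_plus []"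
  "five_cycle_and_vertex = replicate 5 False # five_cycle_plus []"
  "five_cycle_edge_vertex =
     replicate 7 False # (True # replicate 5 False) # replicate 5 False # five_cycle_plus []"
  "triangle_and_vertex = [[False, False, False], [True, True], [True], []]"
  by (simp_all add: five_cycle_plus_def graph_pattern_def numeral_eq_Suc)

lemma five_cycle_copy:
  assumes "five_cycle S a b c d e"
  shows "induced_copy S (five_cycle_plus []) [e, d, c, b, a]"
proof -
  have "distinct [e, d, c, b, a]"
    using assms adj_irrefl adj_commute[of a c] adj_commute[of b d] adj_commute[of c e]
      adj_commute[of d a] adj_commute[of e b]
    by (auto simp: five_cycle_def)
  then show ?thesis
    using assms adj_commute[of b a] adj_commute[of c b] adj_commute[of c a] adj_commute[of d b]
      adj_commute[of d c] adj_commute[of e c] adj_commute[of e d]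
    by (auto simp: induced_copy_def five_cycle_def five_cycle_plus_def graph_pattern_def)
qed

lemma occurs_five_cycle_and_uniform_vertex:
  assumes cycle: "five_cycle S a b c d e" and v: "v \<in> S" "\<And>x. x \<in> {a, b, c, d, e} \<Longrightarrow> E v x = \<beta>"
  shows "occurs S (replicate 5 \<beta> # five_cycle_plus [])"
proof -
  have rows: "map (E v) [e, d, c, b, a] = replicate 5 \<beta>" using v(2) by (simp add: numeral_eq_Suc)
  have "v \<notin> {a, b, c, d, e}"
    using cycle v(2) adj_irrefl[of v] by (auto simp: five_cycle_def)
  then have "induced_copy S (replicate 5 \<beta> # five_cycle_plus []) [v, e, d, c, b, a]"
    using induced_copy_Cons[OF five_cycle_copy[OF cycle] v(1)] unfolding rows by simp
  then show ?thesis unfolding occurs_def by blast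
qed

lemma occurs_five_cycle_edge_vertex:
  assumes cycle: "five_cycle (missing S x y) a b c d e" and xy: "x \<in> S" "y \<in> S" "E x y"
    and v: "v \<in> missing S x y" "\<And>u. u \<in> {a, b, c, d, e} \<Longrightarrow> \<not> E v u"
  shows "occurs S five_cycle_edge_vertex"
proof -
  note yx = adj_sym[OF xy(3)]
  have rows: "map (E x) [e, d, c, b, a] = replicate 5 False"
    "map (E y) [x, e, d, c, b, a] = True # replicate 5 False"
    "map (E v) [y, x, e, d, c, b, a] = replicate 7 False"
    using cycle v yx adj_sym[of v x] adj_sym[of v y] by (auto simp: five_cycle_def numeral_eq_Suc)
  have "x \<notin> {a, b, c, d, e}" "y \<notin> {a, b, c, d, e}" "x \<noteq> y" "v \<noteq> x" "v \<noteq> y"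
    using cycle v(1) xy(3) yx adj_irrefl by (auto simp: five_cycle_def)
  moreover have "v \<notin> {a, b, c, d, e}" using cycle v(2) by (auto simp: five_cycle_def)
  moreover have "five_cycle S a b c d e" using cycle five_cycle_mono missing_subset by blast
  note five_cycle_copy[OF this]
  ultimately have "induced_copy S (map (E v) [y, x, e, d, c, b, a] #
      map (E y) [x, e, d, c, b, a] # map (E x) [e, d, c, b, a] # five_cycle_plus [])
      [v, y, x, e, d, c, b, a]"
    using xy(1,2) v(1) by (intro induced_copy_Cons) auto
  then show ?thesis unfolding rows pattern_rows occurs_def by blast
qed

lemma occurs_triangle_and_vertex:
  assumes "has_clique 3 {x \<in> S. \<not> E v x}" "v \<in> S"
  shows "occurs S triangle_and_vertex"
proof -
  obtain a b c where abc: "{a, b, c} \<subseteq> S" "\<not> E v a" "\<not> E v b" "\<not> E v c"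
    and edges: "E a b" "E a c" "E b c"
    using assms(1) unfolding has_clique_3_iff by blast
  then have adj: "E b a" "E c a" "E c b" using adj_sym by auto
  then have "distinct [v, c, b, a]" using abc edges adj_irrefl by auto
  moreover have "matches triangle_and_vertex [v, c, b, a]"
    using abc adj unfolding pattern_rows by simp
  ultimately have "induced_copy S triangle_and_vertex [v, c, b, a]"
    using abc(1) assms(2) by (simp add: induced_copy_def)
  then show ?thesis unfolding occurs_def by blast
qed

lemma critical_K4_2K2_free_avoids:
  assumes "critical S 4" "\<not> has_clique 4 S" "\<not> has_induced_matching 2 S"
  shows "\<not> occurs S five_wheel" "\<not> occurs S five_cycle_and_vertex" "\<not> occurs S triangle_and_vertex"
proof -
  interpret refutation E S 4 K4_2K2 using refutation_K4_2K2[OF assms] .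
  have "five_wheel \<in> fst ` set K4_2K2_steps" "five_cycle_and_vertex \<in> fst ` set K4_2K2_steps"
    "triangle_and_vertex \<in> fst ` set K4_2K2_steps"
    by (simp_all add: K4_2K2_steps_def)
  from this[THEN refutes_sound[OF K4_2K2_steps_refute]] show "\<not> occurs S five_wheel"
    "\<not> occurs S five_cycle_and_vertex" "\<not> occurs S triangle_and_vertex" .
qed

lemma critical_K3_3K2_free_avoids:
  assumes "critical S 4" "\<not> has_clique 3 S" "\<not> has_induced_matching 3 S"
  shows "\<not> occurs S five_cycle_edge_vertex"
proof -
  interpret refutation E S 4 K3_3K2 using refutation_K3_3K2[OF assms] .
  have "five_cycle_edge_vertex \<in> fst ` set K3_3K2_steps"
    by (simp add: K3_3K2_steps_def)
  then show ?thesis by (rule refutes_sound[OF K3_3K2_steps_refute])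
qed

theorem colorable_4_K4_2K2_free:
  assumes "finite S" "\<not> has_clique 4 S" "\<not> has_induced_matching 2 S"
  shows "colorable S 4"
proof (rule ccontr)
  assume "\<not> ?thesis"
  then obtain T where T: "T \<subseteq> S" "critical T 4" using critical_subset[OF assms(1)] by blast
  have no_K4: "\<not> has_clique 4 T" and no_2K2: "\<not> has_induced_matching 2 T"
    using assms(2,3) T(1) has_clique_mono has_induced_matching_mono by blast+
  note avoids = critical_K4_2K2_free_avoids[OF T(2) no_K4 no_2K2]
  have not_colorable: "\<not> colorable T 4" using T(2) by (simp add: critical_def)
  then obtain v where v: "v \<in> T" using colorable_def by blast
  let ?N = "nbrs T v" and ?M = "{x \<in> T. \<not> E v x}"
  have "\<not> has_clique 3 ?N" using not_has_clique_nbrs[of 3 T v] no_K4 v by simp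
  moreover have "\<not> has_induced_matching 2 ?N"
    using no_2K2 has_induced_matching_mono[of 2 ?N T] by auto
  moreover have "\<not> five_cycle ?N a b c d e" for a b c d e
  proof
    assume cycle: "five_cycle ?N a b c d e"
    then have "five_cycle T a b c d e" by (rule five_cycle_mono) simp
    from occurs_five_cycle_and_uniform_vertex[OF this v, of True] cycle
    show False using avoids(1) unfolding pattern_rows five_cycle_def by auto
  qed
  ultimately have "colorable ?N 2" using colorable_2_or_five_cycle by metis
  have "\<not> has_clique 3 ?M" using occurs_triangle_and_vertex[OF _ v] avoids(3) by blast
  moreover have "\<not> has_induced_matching 2 ?M"
    using no_2K2 has_induced_matching_mono[of 2 ?M T] by auto
  moreover have "\<not> five_cycle ?M a b c d e" for a b c d e
  proof
    assume cycle: "five_cycle ?M a b c d e"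
    then have "five_cycle T a b c d e" by (rule five_cycle_mono) blast
    from occurs_five_cycle_and_uniform_vertex[OF this v, of False] cycle
    show False using avoids(2) unfolding pattern_rows five_cycle_def by auto
  qed
  ultimately have "colorable ?M 2" using colorable_2_or_five_cycle by metis
  from colorable_Un[OF \<open>colorable ?N 2\<close> this] have "colorable T 4" by (rule colorable_mono) auto
  then show False using not_colorable by blast
qed

lemma five_cycle_opposite_nbr:
  assumes "\<not> has_induced_matching 2 S" "five_cycle S a b c d e" "v \<in> S" "E v a"
  shows "E v c \<or> E v d"
  using stableD[OF stable_missing[OF assms(1,3) _ assms(4)], of c d] assms(2) adj_sym[of a d]
  by (auto simp: five_cycle_def)

lemma five_cycle_clones_adjacent:
  assumes no_triangle: "\<not> has_clique 3 S" and no_2K2: "\<not> has_induced_matching 2 S"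
    and cycle: "five_cycle S a b c d e"
    and p: "p \<in> S" "E p e" "E p b" and q: "q \<in> S" "E q a" "E q c"
  shows "E p q"
proof (rule ccontr)
  assume "\<not> E p q"
  moreover have "\<not> E e q" "\<not> E p c" "\<not> E e c"
    using stableD[OF stable_nbrs[OF no_triangle, of a], of e q] cycle p q adj_sym
      stableD[OF stable_nbrs[OF no_triangle, of b], of p c]
    by (auto simp: five_cycle_def)
  moreover have "c \<in> S" "e \<in> S" using cycle by (auto simp: five_cycle_def)
  ultimately show False
    using stableD[OF stable_missing[OF no_2K2 p(1) _ p(2)], of q c] q(1,3) by simp
qed

text \<open>
  A dominating 5-cycle makes S a blow-up of the cycle, and the neighbours of u miss two of its
  classes that are consecutive. The three sets below are the classes of a and c, of b and d, and
  of e.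
\<close>

lemma triangle_free_nbrs_in_five_cycle:
  assumes no_triangle: "\<not> has_clique 3 S" and no_2K2: "\<not> has_induced_matching 2 S"
    and cycle: "five_cycle S a b c d e"
    and dom: "\<And>v. v \<in> S \<Longrightarrow> E v a \<or> E v b \<or> E v c \<or> E v d \<or> E v e"
    and u: "stable (nbrs S u)"
  shows "nbrs (nbrs S b) u = {} \<or> nbrs (nbrs S c) u = {} \<or> nbrs (missing S b c) u = {}"
proof (rule ccontr)
  assume "\<not> ?thesis"
  then obtain p q r where "p \<in> nbrs (nbrs S b) u" "q \<in> nbrs (nbrs S c) u"
    and "r \<in> nbrs (missing S b c) u"
    by blast
  then have p: "p \<in> S" "E p b" and q: "q \<in> S" "E q c" and r: "r \<in> S" "\<not> E r b" "\<not> E r c"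
    and "p \<in> nbrs S u" "q \<in> nbrs S u" "r \<in> nbrs S u"
    using adj_sym by auto
  then have nonadjacent: "\<not> E q p" "\<not> E r p" "\<not> E q r" using stableD[OF u] by blast+
  note cycle_b = five_cycle_rotate[OF cycle]
  note cycle_c = five_cycle_rotate[OF cycle_b]
  note cycle_d = five_cycle_rotate[OF cycle_c]
  note cycle_e = five_cycle_rotate[OF cycle_d]
  note opposite = five_cycle_opposite_nbr[OF no_2K2]
    and adjacent = five_cycle_clones_adjacent[OF no_triangle no_2K2]
  have r_clone: "E r d" "E r a"
    using dom[OF r(1)] opposite[OF cycle r(1)] opposite[OF cycle_d r(1)] opposite[OF cycle_e r(1)]
      r(2,3) by auto
  have "\<not> E p e" using adjacent[OF cycle_e r(1) r_clone p(1) _ p(2)] nonadjacent by blast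
  then have "E p d" using opposite[OF cycle_b p] by blast
  have "\<not> E q e" using adjacent[OF cycle_d q _ r(1) r_clone] nonadjacent by blast
  then have "E q a" using opposite[OF cycle_c q] by blast
  then show False using adjacent[OF cycle_b q(1) _ q(2) p \<open>E p d\<close>] nonadjacent by blast
qed

lemma colorable_4_dominating_five_cycle:
  assumes no_triangle: "\<not> has_clique 3 S" and no_3K2: "\<not> has_induced_matching 3 S"
    and xy: "x \<in> S" "y \<in> S" "E x y" and cycle: "five_cycle (missing S x y) a b c d e"
    and dom: "\<And>v. v \<in> missing S x y \<Longrightarrow> E v a \<or> E v b \<or> E v c \<or> E v d \<or> E v e"
  shows "colorable S 4"
proof -
  let ?A = "missing S x y"
  have no_triangle_A: "\<not> has_clique 3 ?A" using no_triangle has_clique_mono[of 3 ?A S] by auto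
  have no_2K2_A: "\<not> has_induced_matching 2 ?A"
    using no_3K2 xy unfolding has_induced_matching_3_iff by blast
  have bc: "b \<in> ?A" "c \<in> ?A" "E b c" using cycle by (auto simp: five_cycle_def)
  define extend where "extend B = B \<union> {u \<in> nbrs S y. nbrs B u = {}}" for B
  have extend: "colorable (extend B) 1" if "stable B" for B
    unfolding extend_def
  proof (intro colorable_stable stable_Un that)
    show "stable {u \<in> nbrs S y. nbrs B u = {}}"
      by (rule stable_mono[OF stable_nbrs[OF no_triangle xy(2)]]) blast
    show "\<not> E u v" if "u \<in> B" "v \<in> {u \<in> nbrs S y. nbrs B u = {}}" for u v
      using that adj_sym[of u v] by auto
  qed
  let ?U = "nbrs S x \<union> (extend (nbrs ?A b) \<union> (extend (nbrs ?A c) \<union> extend (missing ?A b c)))"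
  have "v \<in> ?U" if v: "v \<in> S" for v
  proof -
    have "stable (nbrs ?A v)" by (rule stable_mono[OF stable_nbrs[OF no_triangle v]]) auto
    from triangle_free_nbrs_in_five_cycle[OF no_triangle_A no_2K2_A cycle dom this]
    show ?thesis using v by (auto simp: extend_def)
  qed
  moreover have "colorable ?U (1 + (1 + (1 + 1)))"
    using no_triangle no_triangle_A no_2K2_A xy(1) bc
    by (intro colorable_Un extend colorable_stable stable_nbrs stable_missing) auto
  ultimately show ?thesis using colorable_mono[OF _ subsetI] by simp
qed

theorem colorable_4_K3_3K2_free:
  assumes "finite S" "\<not> has_clique 3 S" "\<not> has_induced_matching 3 S"
  shows "colorable S 4"
proof (rule ccontr)
  assume "\<not> ?thesis"
  then obtain T where T: "T \<subseteq> S" "critical T 4" using critical_subset[OF assms(1)] by blast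
  have no_triangle: "\<not> has_clique 3 T" and no_3K2: "\<not> has_induced_matching 3 T"
    using assms(2,3) T(1) has_clique_mono has_induced_matching_mono by blast+
  have not_colorable: "\<not> colorable T 4" using T(2) by (simp add: critical_def)
  have "has_clique 2 T" using colorable_1 colorable_mono[of T 1 T 4] not_colorable by auto
  then obtain x y where xy: "x \<in> T" "y \<in> T" "E x y" unfolding has_clique_2_iff by blast
  let ?A = "missing T x y"
  have no_triangle_A: "\<not> has_clique 3 ?A" using no_triangle has_clique_mono[of 3 ?A T] by auto
  have no_2K2_A: "\<not> has_induced_matching 2 ?A"
    using no_3K2 xy unfolding has_induced_matching_3_iff by blast
  show False
  proof (rule colorable_2_or_five_cycle[OF no_triangle_A no_2K2_A])
    assume "colorable ?A 2"
    then have "colorable T (2 + 2 * 1)"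
      using no_triangle xy by (intro colorable_edge_partition colorable_stable stable_nbrs)
    then show False using not_colorable by simp
  next
    fix a b c d e
    assume cycle: "five_cycle ?A a b c d e"
    have "E v a \<or> E v b \<or> E v c \<or> E v d \<or> E v e" if v: "v \<in> ?A" for v
    proof (rule ccontr)
      assume "\<not> ?thesis"
      then have "occurs T five_cycle_edge_vertex"
        by (intro occurs_five_cycle_edge_vertex[OF cycle xy v]) auto
      then show False
        using critical_K3_3K2_free_avoids[OF T(2) no_triangle no_3K2] by blast
    qed
    from colorable_4_dominating_five_cycle[OF no_triangle no_3K2 xy cycle this]
    show False using not_colorable by blast
  qed
qed

end

section \<open>The recursive bounds\<close>

lemma gbound_0: "gbound p 0 = 0"
  by (subst gbound.simps) simp

lemma gbound_Suc:
  assumes "2 \<le> p" "2 \<le> m" "(p, m) \<noteq> (2, 2)"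
  shows "gbound (Suc p) m = gbound p m + 2 * (m - 1)"
  using assms gbound_eqs(4)[of "Suc p"] gbound_eqs(4)[of p] gbound_eqs(5)[of "Suc p" m]
  by (cases "m = 2") auto

lemma gbound_le_Suc: "2 \<le> p \<Longrightarrow> gbound p m \<le> gbound p (Suc m)"
proof (induction p rule: nat_induct_at_least)
  case base
  consider "m = 0" | "m = 1" | "m = 2" | "m \<ge> 3" by linarith
  then show ?case
    using gbound_eqs(1,2) gbound_eqs(3)[of m] gbound_eqs(3)[of "Suc m"]
    by cases (auto simp: gbound_0 numeral_2_eq_2 numeral_3_eq_3)
next
  case (Suc p)
  consider "m = 0" | "m = 1" | "p = 2" "m = 2" | "2 \<le> m" "(p, m) \<noteq> (2, 2)" by fastforce
  then show ?case
  proof cases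
    case 3
    then show ?thesis
      using gbound_eqs(4)[of 3] gbound_eqs(3)[of 3] gbound_Suc[of 2 3] by (simp add: numeral_3_eq_3)
  next
    case 4
    then show ?thesis
      using Suc.IH gbound_Suc[of p m] gbound_Suc[of p "Suc m"] Suc.hyps by simp
  qed (use gbound_eqs(1)[of "Suc p"] gbound_eqs(4)[of "Suc p"] Suc.hyps in
      \<open>auto simp: gbound_0 numeral_2_eq_2\<close>)
qed

lemma gbound_mono: "2 \<le> p \<Longrightarrow> i \<le> m \<Longrightarrow> gbound p i \<le> gbound p m"
  using gbound_le_Suc by (rule lift_Suc_mono_le)

lemma fbound_0: "fbound p 0 = 0"
  by (subst fbound.simps) simp

lemma fbound_Suc:
  assumes "2 \<le> p" "3 \<le> m"
  shows "fbound (Suc p) m = fbound p m + 2 * gbound p (m - 1) + (3 * m - 6)"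
proof (cases "m = 3")
  case True
  have "int (fbound (Suc p) 3) = int (fbound p 3) + 2 * int (gbound p 2) + 3"
  proof (cases "p = 2")
    case True
    then show ?thesis using fbound_eqs(3) fbound_eqs(7)[of 3] gbound_eqs(2) by simp
  next
    case False
    then have p: "3 \<le> p" using assms by simp
    then have "int (gbound p 2) = 2 * int p - 2"
      using gbound_eqs(4)[of p] by (simp add: of_nat_diff)
    then show ?thesis
      using fbound_eqs(7)[of p] fbound_eqs(7)[of "Suc p"] p
      by (simp add: power2_eq_square algebra_simps)
  qed
  then show ?thesis using True by simp
next
  case False
  then show ?thesis using fbound_eqs(8)[of "Suc p" m] assms by simp
qed

lemma fbound_Suc_le:
  assumes "2 \<le> p" and step: "fbound p m \<le> fbound p (Suc m) + 1"
  shows "fbound (Suc p) m \<le> fbound (Suc p) (Suc m)"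
proof -
  consider "m = 0" | "m = 1" | "m = 2" | "3 \<le> m" by linarith
  then show ?thesis
  proof cases
    case 3
    have "p \<le> gbound p 2" using gbound_eqs(2) gbound_eqs(4)[of p] assms(1) by (cases "p = 2") auto
    then show ?thesis
      using 3 fbound_eqs(6)[of "Suc p"] fbound_Suc[of p 3] assms(1) by simp
  next
    case 4
    then show ?thesis
      using step fbound_Suc[of p m] fbound_Suc[of p "Suc m"] gbound_mono[of p "m - 1" m] assms(1)
      by simp
  qed (use fbound_eqs(1)[of "Suc p"] fbound_eqs(6)[of "Suc p"] assms(1) in
      \<open>auto simp: fbound_0 numeral_2_eq_2\<close>)
qed

lemma fbound_le_Suc: "3 \<le> p \<Longrightarrow> fbound p m \<le> fbound p (Suc m)"
proof (induction p rule: nat_induct_at_least)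
  case base
  have "fbound 2 m \<le> fbound 2 (Suc m) + 1" by (subst (1 2) fbound.simps) auto
  then show ?case using fbound_Suc_le[of 2 m] by (simp add: numeral_3_eq_3)
next
  case (Suc p)
  then show ?case using fbound_Suc_le[of p m] by simp
qed

lemma fbound_mono:
  assumes "2 \<le> p" "i \<le> m" "(p, m) \<noteq> (2, 5)"
  shows "fbound p i \<le> fbound p m"
proof (cases "p = 2")
  case True
  then show ?thesis using assms(2,3) by (subst (1 2) fbound.simps) auto
next
  case False
  then have "3 \<le> p" using assms(1) by simp
  then show ?thesis using lift_Suc_mono_le[of "fbound p", OF fbound_le_Suc] assms(2) by blast
qed

lemma fbound_2_le_6: "i \<le> 5 \<Longrightarrow> fbound 2 i \<le> 6"
  by (subst fbound.simps) auto

context simple_graph begin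

lemma colorable_gbound_2:
  assumes "\<not> has_induced_matching 2 S" "clique_minus_edge_free 2 S" "\<not> has_clique (Suc m) S"
  shows "colorable S (gbound 2 m)"
proof -
  obtain i where i: "i \<le> m" "has_clique i S" "\<not> has_clique (Suc i) S"
    using obtain_clique_number[OF assms(3)] .
  consider "i = 0" | "i = 1" | "i = 2" | "3 \<le> i" by linarith
  then have "colorable S (gbound 2 i)"
  proof cases
    case 1
    then show ?thesis using i(3) colorable_0 by (simp add: gbound_0)
  next
    case 2
    then show ?thesis using i(3) colorable_1 gbound_eqs(1) by (simp add: numeral_2_eq_2)
  next
    case 3
    then show ?thesis
      using i(3) colorable_3_triangle_free_2K2_free[OF _ assms(1)] gbound_eqs(2)
      by (simp add: numeral_3_eq_3)
  next
    case 4
    obtain K where K: "maximum_clique K S" "card K = i" using obtain_maximum_clique[OF i(2,3)] .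
    then show ?thesis
      using colorable_clique_number[OF assms(1) K(1) assms(2)] gbound_eqs(3)[of i] 4 by simp
  qed
  then show ?thesis by (rule colorable_mono) (use gbound_mono i(1) in auto)
qed

lemma colorable_nbrs_diamond_free:
  assumes "finite S" "clique_minus_edge_free 2 S" "\<not> has_clique (Suc m) S" "1 \<le> m" "v \<in> S"
  shows "colorable (nbrs S v) (m - 1)"
proof (rule colorable_P3_free)
  show "finite (nbrs S v)" using assms(1) by simp
  show "clique_minus_edge_free 1 (nbrs S v)"
    using clique_minus_edge_free_nbrs[of 1] assms(2,5) by (simp add: numeral_2_eq_2)
  show "\<not> has_clique (Suc (m - 1)) (nbrs S v)"
    using not_has_clique_nbrs[OF assms(3,5)] assms(4) by simp
qed

lemma colorable_edge_partition_diamond_free: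
  assumes "finite S" "clique_minus_edge_free 2 S" "\<not> has_clique (Suc m) S" "2 \<le> m"
    and missing: "\<And>x y. \<lbrakk>x \<in> S; y \<in> S; E x y\<rbrakk> \<Longrightarrow> colorable (missing S x y) k"
  shows "colorable S (k + 2 * (m - 1))"
proof (cases "has_clique 2 S")
  case True
  then obtain x y where xy: "x \<in> S" "y \<in> S" "E x y" unfolding has_clique_2_iff by blast
  have "colorable (nbrs S v) (m - 1)" if "v \<in> S" for v
    using colorable_nbrs_diamond_free[OF assms(1-3) _ that] assms(4) by simp
  then show ?thesis using colorable_edge_partition[OF missing[OF xy]] xy(1,2) by blast
next
  case False
  then show ?thesis using colorable_mono[OF colorable_1, of S S] assms(4) by simp
qed

theorem colorable_gbound:
  assumes "2 \<le> p" "finite S" "\<not> has_induced_matching p S" "clique_minus_edge_free 2 S"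
    and "\<not> has_clique (Suc m) S"
  shows "colorable S (gbound p m)"
  using assms
proof (induction p arbitrary: S m rule: nat_induct_at_least)
  case base
  then show ?case using colorable_gbound_2 by blast
next
  case (Suc p)
  consider "m = 0" | "m = 1" | "p = 2" "m = 2" | "2 \<le> m" "(p, m) \<noteq> (2, 2)" by fastforce
  then show ?case
  proof cases
    case 1
    then show ?thesis using Suc.prems(4) colorable_0 by (simp add: gbound_0)
  next
    case 2
    then show ?thesis using Suc.prems(4) colorable_1 gbound_eqs(1) by (simp add: numeral_2_eq_2)
  next
    case 3
    then have "\<not> has_clique 3 S" "\<not> has_induced_matching 3 S" using Suc.prems(2,4) by simp_all
    then show ?thesis
      using colorable_4_K3_3K2_free[OF Suc.prems(1)] gbound_eqs(4)[of 3] 3 by simp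
  next
    case 4
    have "colorable (missing S x y) (gbound p m)" if "x \<in> S" "y \<in> S" "E x y" for x y
      using Suc.prems(1,4) clique_minus_edge_free_mono[OF Suc.prems(3) missing_subset]
        not_has_induced_matching_missing[OF Suc.prems(2) that] has_clique_mono[OF _ missing_subset]
      by (intro Suc.IH) auto
    from colorable_edge_partition_diamond_free[OF Suc.prems(1,3,4) 4(1) this]
    show ?thesis unfolding gbound_Suc[OF Suc.hyps 4] by blast
  qed
qed

lemma colorable_common_nbrs:
  assumes "finite S" "clique_minus_edge_free 3 S" "\<not> has_clique (Suc m) S" "2 \<le> m"
    and "x \<in> S" "y \<in> S" "E x y"
  shows "colorable (nbrs (nbrs S x) y) (m - 2)"
proof -
  have "clique_minus_edge_free 2 (nbrs S x)"
    using clique_minus_edge_free_nbrs[of 2] assms(2,5) by (simp add: numeral_3_eq_3 numeral_2_eq_2)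
  moreover have "\<not> has_clique (Suc (m - 1)) (nbrs S x)"
    using not_has_clique_nbrs[OF assms(3,5)] assms(4) by simp
  ultimately have "colorable (nbrs (nbrs S x) y) (m - 1 - 1)"
    using assms(1,4,6,7) by (intro colorable_nbrs_diamond_free) auto
  then show ?thesis by (simp add: numeral_2_eq_2)
qed

lemma colorable_private_nbrs:
  assumes "2 \<le> p" "finite S" "\<not> has_induced_matching (Suc p) S" "clique_minus_edge_free 3 S"
    and "\<not> has_clique (Suc m) S" "1 \<le> m" "x \<in> S" "y \<in> S" "z \<in> S" "E y z"
  shows "colorable (nbrs (missing S y z) x) (gbound p (m - 1))"
proof (rule colorable_gbound[OF assms(1)])
  let ?T = "nbrs (missing S y z) x"
  have T: "?T \<subseteq> missing S y z" "?T \<subseteq> nbrs S x" by auto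
  show "finite ?T" using assms(2) by simp
  show "\<not> has_induced_matching p ?T"
    using not_has_induced_matching_missing[OF assms(3,8-10)] has_induced_matching_mono T(1) by blast
  show "clique_minus_edge_free 2 ?T"
    using clique_minus_edge_free_nbrs[of 2 S x] assms(4,7) clique_minus_edge_free_mono T(2)
    by (simp add: numeral_3_eq_3 numeral_2_eq_2)
  show "\<not> has_clique (Suc (m - 1)) ?T"
    using not_has_clique_nbrs[OF assms(5,7)] has_clique_mono[OF _ T(2)] assms(6) by auto
qed

lemma colorable_triangle_partition:
  assumes "2 \<le> p" "finite S" "\<not> has_induced_matching (Suc p) S" "clique_minus_edge_free 3 S"
    and "\<not> has_clique (Suc m) S" "3 \<le> m" and xyz: "x \<in> S" "y \<in> S" "z \<in> S" "E x y" "E x z" "E y z"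
    and missing: "colorable (missing S x y) k"
  shows "colorable S (k + 2 * gbound p (m - 1) + (3 * m - 6))"
proof -
  have "1 \<le> m" "2 \<le> m" using assms(6) by simp_all
  then have "colorable (missing S x y \<union> (nbrs (missing S y z) x \<union> nbrs (missing S x z) y) \<union>
      (nbrs (nbrs S x) y \<union> (nbrs (nbrs S x) z \<union> nbrs (nbrs S y) z)))
      (k + (gbound p (m - 1) + gbound p (m - 1)) + (m - 2 + (m - 2 + (m - 2))))"
    using xyz
    by (intro colorable_Un missing colorable_private_nbrs[OF assms(1-5)]
        colorable_common_nbrs[OF assms(2,4,5)])
  then show ?thesis by (rule colorable_mono) (use assms(6) in auto)
qed

text \<open>
  In a 3K2-free graph with clique number 5 the vertices missing an edge may need 6 colors, one
  more than the recursion grants. A whole 5-clique xyzab makes up for this: the common neighbours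
  of x, z or of y, z outside the clique miss the edge ab, so that 4 colors suffice for them.
\<close>

lemma colorable_5_clique_partition:
  assumes "finite S" and no_3K2: "\<not> has_induced_matching 3 S" and free: "clique_minus_edge_free 3 S"
    and max: "maximum_clique K S" "card K = 5"
    and missing: "\<And>x y. \<lbrakk>x \<in> S; y \<in> S; E x y\<rbrakk> \<Longrightarrow> colorable (missing S x y) 6"
  shows "colorable S 22"
proof -
  note clique = maximum_cliqueD[OF max(1)]
  obtain vs where vs: "set vs = K" "distinct vs" using finite_distinct_list[OF clique(2)] by blast
  then have "length vs = 5" using distinct_card max(2) by metis
  then obtain x y z a b where "vs = [x, y, z, a, b]"
    by (auto simp: numeral_eq_Suc length_Suc_conv)
  then have K: "K = {x, y, z, a, b}" "distinct [x, y, z, a, b]" using vs by auto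
  have mem: "x \<in> S" "y \<in> S" "z \<in> S" "a \<in> S" "b \<in> S" using clique(1) K by auto
  have edges: "E x y" "E x z" "E y z" "E a b" using clique(3) K by (auto simp: pairwise_def)
  have "\<not> has_induced_matching (Suc 2) S" "\<not> has_clique (Suc 5) S"
    using no_3K2 clique(4) max(2) by simp_all
  note bounds = \<open>finite S\<close> this(1) free this(2)
  have private_nbrs: "colorable (nbrs (missing S v w) u) 4"
    if "u \<in> S" "v \<in> S" "w \<in> S" "E v w" for u v w
    using colorable_private_nbrs[OF order_refl bounds _ that] gbound_eqs(3)[of 4] by simp
  let ?X = "insert y (nbrs (missing S y z) x)" and ?Y = "insert x (nbrs (missing S x z) y)"
  let ?Z = "nbrs (missing S a b) z"
  have "colorable ?X 4" "colorable ?Y 4"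
    using private_nbrs mem edges by (auto intro!: colorable_insert_isolated)
  moreover have "colorable (nbrs (nbrs S x) y) 3"
    using colorable_common_nbrs[OF bounds(1,3,4) _ mem(1,2) edges(1)] by simp
  ultimately have "colorable (missing S x y \<union> (?X \<union> ?Y) \<union> (nbrs (nbrs S x) y \<union> ?Z))
      (6 + (4 + 4) + (3 + 4))"
    using mem edges by (intro colorable_Un missing private_nbrs)
  moreover have "v \<in> missing S x y \<union> (?X \<union> ?Y) \<union> (nbrs (nbrs S x) y \<union> ?Z)" if v: "v \<in> S" for v
  proof (cases "v \<in> K")
    case True
    then show ?thesis using K mem edges clique(3) by (auto simp: pairwise_def)
  next
    case False
    then have "\<not> {z, u, w} \<subseteq> nbrs K v" if "distinct [z, u, w]" for u w
      using not_subset_nbrs_maximum_clique[OF max(1) free, of v "{z, u, w}"] v that by simp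
    from this[of x a] this[of x b] this[of y a] this[of y b]
    show ?thesis using v K by (auto simp: adj_commute[of _ v])
  qed
  ultimately show ?thesis using colorable_mono[OF _ subsetI] by simp
qed

lemma colorable_fbound_2:
  assumes S: "finite S" "\<not> has_induced_matching 2 S" and free: "clique_minus_edge_free 3 S"
    and m: "has_clique m S" "\<not> has_clique (Suc m) S"
  shows "colorable S (fbound 2 m)"
proof -
  obtain K where max: "maximum_clique K S" "card K = m" using obtain_maximum_clique[OF m] .
  consider "m = 0" | "m = 1" | "m = 2" | "m = 3" | "m = 4" | "5 \<le> m" by linarith
  then show ?thesis
  proof cases
    case 1
    then show ?thesis using m(2) colorable_0 by (simp add: fbound_0)
  next
    case 2
    then show ?thesis using m(2) colorable_1 fbound_eqs(1) by (simp add: numeral_2_eq_2)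
  next
    case 3
    then show ?thesis using m(2) colorable_3_triangle_free_2K2_free[OF _ S(2)] fbound_eqs(2) by simp
  next
    case 4
    then show ?thesis using m(2) colorable_4_K4_2K2_free[OF S(1) _ S(2)] fbound_eqs(3) by simp
  next
    case 5
    then show ?thesis
      using colorable_6_K5_minus_e_free[OF S(2) free max(1)] max(2) fbound_eqs(4) by simp
  next
    case 6
    then show ?thesis
      using colorable_clique_number[OF S(2) max(1) free] max(2) fbound_eqs(5) by simp
  qed
qed

lemma colorable_fbound_triangle_free:
  assumes "3 \<le> p" "finite S" "\<not> has_induced_matching p S" "\<not> has_clique 3 S"
  shows "colorable S (fbound p 2)"
  using colorable_gbound[of p S 2] clique_minus_edge_free_if_not_has_clique[of 2 S] assms
    gbound_eqs(4) fbound_eqs(6) by simp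

lemma colorable_fbound_Suc:
  assumes p: "2 \<le> p"
    and S: "finite S" "\<not> has_induced_matching (Suc p) S" "clique_minus_edge_free 3 S"
    and m: "has_clique m S" "\<not> has_clique (Suc m) S" "3 \<le> m"
    and missing: "\<And>x y. \<lbrakk>x \<in> S; y \<in> S; E x y\<rbrakk> \<Longrightarrow> \<exists>i\<le>m. colorable (missing S x y) (fbound p i)"
  shows "colorable S (fbound (Suc p) m)"
proof (cases "(p, m) = (2, 5)")
  case True
  obtain K where K: "maximum_clique K S" "card K = 5"
    using obtain_maximum_clique[OF m(1,2)] True by blast
  have "colorable (missing S x y) 6" if "x \<in> S" "y \<in> S" "E x y" for x y
    using missing[OF that] True colorable_mono[OF _ order_refl fbound_2_le_6] by blast
  moreover have "Suc p = 3" using True by simp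
  then have "\<not> has_induced_matching 3 S" using S(2) by metis
  ultimately have "colorable S 22"
    using colorable_5_clique_partition[OF S(1) _ S(3) K] by blast
  then show ?thesis
    using True fbound_Suc[of 2 5] gbound_eqs(3)[of 4] fbound_eqs(5)[of 5] by simp
next
  case False
  obtain x y z where xyz: "x \<in> S" "y \<in> S" "z \<in> S" "E x y" "E x z" "E y z"
    using has_clique_le[OF m(1,3)] unfolding has_clique_3_iff by blast
  obtain i where i: "i \<le> m" "colorable (missing S x y) (fbound p i)"
    using missing[OF xyz(1,2,4)] by blast
  have "colorable (missing S x y) (fbound p m)"
    by (rule colorable_mono[OF i(2) order_refl fbound_mono[OF p i(1) False]])
  from colorable_triangle_partition[OF p S m(2,3) xyz this]
  show ?thesis using fbound_Suc[OF p m(3)] by simp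
qed

theorem colorable_fbound:
  assumes "2 \<le> p" "finite S" "\<not> has_induced_matching p S" "clique_minus_edge_free 3 S"
    and "has_clique m S" "\<not> has_clique (Suc m) S"
  shows "colorable S (fbound p m)"
  using assms
proof (induction p arbitrary: S m rule: nat_induct_at_least)
  case base
  then show ?case using colorable_fbound_2 by blast
next
  case (Suc p)
  consider "m = 0" | "m = 1" | "m = 2" | "3 \<le> m" by linarith
  then show ?case
  proof cases
    case 1
    then show ?thesis using Suc.prems(5) colorable_0 by (simp add: fbound_0)
  next
    case 2
    then show ?thesis using Suc.prems(5) colorable_1 fbound_eqs(1) by (simp add: numeral_2_eq_2)
  next
    case 3
    then show ?thesis using colorable_fbound_triangle_free[of "Suc p" S] Suc.prems Suc.hyps by simp
  next
    case 4
    have "\<exists>i\<le>m. colorable (missing S x y) (fbound p i)" if "x \<in> S" "y \<in> S" "E x y" for x y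
    proof -
      let ?A = "missing S x y"
      have "\<not> has_clique (Suc m) ?A"
        using Suc.prems(5) has_clique_mono[OF _ missing_subset] by blast
      then obtain i where i: "i \<le> m" "has_clique i ?A" "\<not> has_clique (Suc i) ?A"
        by (rule obtain_clique_number)
      have "colorable ?A (fbound p i)"
        using Suc.prems(1) clique_minus_edge_free_mono[OF Suc.prems(3) missing_subset]
          not_has_induced_matching_missing[OF Suc.prems(2) that] i(2,3)
        by (intro Suc.IH) simp_all
      then show ?thesis using i(1) by blast
    qed
    then show ?thesis using colorable_fbound_Suc[OF Suc.hyps Suc.prems 4] by blast
  qed
qed

end

section \<open>Induced subgraphs of finite simple graphs\<close>

lemma induced_subgraph_if_embedding:
  assumes G: "pair_wf_digraph G" and H: "pair_wf_digraph H"
    and inj: "inj_on f (pverts H)" and sub: "f ` pverts H \<subseteq> pverts G"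
    and arcs: "\<And>i j. \<lbrakk>i \<in> pverts H; j \<in> pverts H\<rbrakk> \<Longrightarrow> (f i, f j) \<in> parcs G \<longleftrightarrow> (i, j) \<in> parcs H"
  shows "\<exists>K. induced_subgraph K (with_proj G) \<and> digraph_iso K (with_proj H)"
proof -
  interpret G: pair_wf_digraph G by (rule G)
  interpret H: pair_wf_digraph H by (rule H)
  let ?K = "with_proj G \<restriction> (f ` pverts H)"
  let ?iso = "\<lparr>iso_verts = f, iso_arcs = map_prod f f, iso_head = snd, iso_tail = fst\<rparr>"
  have "parcs H \<subseteq> pverts H \<times> pverts H" using H.in_arcsD1 H.in_arcsD2 by auto
  then have "inj_on (map_prod f f) (parcs H)"
    using inj_on_subset[OF map_prod_inj_on[OF inj inj]] by blast
  then have "H.digraph_isomorphism ?iso"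
    unfolding H.digraph_isomorphism_def using inj H.wf_digraph_axioms by auto
  moreover have "map_prod f f ` parcs H =
      {e \<in> parcs G. fst e \<in> f ` pverts H \<and> snd e \<in> f ` pverts H}"
    using arcs H.in_arcsD1 H.in_arcsD2 by (auto 4 3 intro: rev_image_eqI)
  then have "app_iso ?iso (with_proj H) = ?K"
    by (simp add: app_iso_def induce_subgraph_def)
  ultimately have "digraph_iso (with_proj H) ?K" unfolding digraph_iso_def by metis
  then have "digraph_iso ?K (with_proj H)" by (rule digraph_iso_swap[OF H.wf_digraph_axioms])
  then show ?thesis using G.induced_induce[of "f ` pverts H"] sub by auto
qed

lemma (in simple_graph) has_induced_matching_embedding:
  "has_induced_matching k S \<Longrightarrow> \<exists>f :: nat \<Rightarrow> 'a. inj_on f {..<2 * k} \<and> f ` {..<2 * k} \<subseteq> S \<and>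
     (\<forall>i<2 * k. \<forall>j<2 * k. E (f i) (f j) \<longleftrightarrow> i \<noteq> j \<and> i div 2 = j div 2)"
proof (induction k arbitrary: S)
  case (Suc k)
  then obtain a b where ab: "a \<in> S" "b \<in> S" "E a b" "has_induced_matching k (missing S a b)" by auto
  obtain f :: "nat \<Rightarrow> 'a" where f: "inj_on f {..<2 * k}" "f ` {..<2 * k} \<subseteq> missing S a b"
      "\<And>i j. \<lbrakk>i < 2 * k; j < 2 * k\<rbrakk> \<Longrightarrow> E (f i) (f j) \<longleftrightarrow> i \<noteq> j \<and> i div 2 = j div 2"
    using Suc.IH[OF ab(4)] by blast
  define h where "h i = (case i of 0 \<Rightarrow> a | Suc 0 \<Rightarrow> b | Suc (Suc n) \<Rightarrow> f n)" for i
  have h: "h 0 = a" "h (Suc 0) = b" "\<And>n. h (Suc (Suc n)) = f n" by (simp_all add: h_def)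
  have new: "f n \<in> S" "\<not> E a (f n)" "\<not> E b (f n)" "\<not> E (f n) a" "\<not> E (f n) b" "f n \<noteq> a" "f n \<noteq> b"
    if "n < 2 * k" for n
  proof -
    have "f n \<in> missing S a b" using f(2) that by auto
    then show "f n \<in> S" "\<not> E a (f n)" "\<not> E b (f n)" "\<not> E (f n) a" "\<not> E (f n) b" "f n \<noteq> a" "f n \<noteq> b"
      using ab(3) adj_sym[OF ab(3)] adj_sym[of "f n"] by auto
  qed
  have index: "i = 0 \<or> i = Suc 0 \<or> (\<exists>n<2 * k. i = Suc (Suc n))" if "i < 2 * Suc k" for i
    using that by (cases i; cases "i - 1") auto
  have "h i \<in> S" if "i < 2 * Suc k" for i
    using index[OF that] ab(1,2) new(1) by (auto simp: h)
  moreover have "h i = h j \<longleftrightarrow> i = j" if "i < 2 * Suc k" "j < 2 * Suc k" for i j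
    using index[OF that(1)] index[OF that(2)] ab(3) adj_irrefl new(6,7) inj_onD[OF f(1)]
    by (elim disjE exE) (auto simp: h)
  moreover have "E (h i) (h j) \<longleftrightarrow> i \<noteq> j \<and> i div 2 = j div 2"
    if "i < 2 * Suc k" "j < 2 * Suc k" for i j
    using index[OF that(1)] index[OF that(2)] ab(3) adj_sym[OF ab(3)] adj_irrefl new(2-5) f(3)
    by (elim disjE exE) (auto simp: h)
  ultimately show ?case by (intro exI[of _ h]) (auto simp: inj_on_def)
qed simp

lemma pair_wf_pK2: "pair_wf_digraph (pK2 p)"
  by unfold_locales (auto simp: pK2_def)

lemma pair_wf_K5_minus_e: "pair_wf_digraph K5_minus_e"
  by unfold_locales (auto simp: K5_minus_e_def)

lemma family_freeD:
  assumes "family_free F G" "H \<in> F" "pair_wf_digraph G" "pair_wf_digraph H"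
    and "inj_on f (pverts H)" "f ` pverts H \<subseteq> pverts G"
  shows "\<exists>i\<in>pverts H. \<exists>j\<in>pverts H. \<not> ((f i, f j) \<in> parcs G \<longleftrightarrow> (i, j) \<in> parcs H)"
  using induced_subgraph_if_embedding[OF assms(3-6)] assms(1,2) unfolding family_free_def by blast

context pair_graph begin

sublocale adj: simple_graph "\<lambda>u v. (u, v) \<in> parcs G"
proof
  show "(v, u) \<in> parcs G" if "(u, v) \<in> parcs G" for u v
    using pair_sym_arcs that unfolding symmetric_def sym_def by simp
  show "(v, v) \<notin> parcs G" for v using pair_no_loops by fastforce
qed

lemma not_has_induced_matching_if_pK2_free:
  assumes "family_free F G" "pK2 p \<in> F"
  shows "\<not> adj.has_induced_matching p (pverts G)"
proof
  assume "adj.has_induced_matching p (pverts G)"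
  then obtain f :: "nat \<Rightarrow> 'a" where f: "inj_on f {..<2 * p}" "f ` {..<2 * p} \<subseteq> pverts G"
      "\<forall>i<2 * p. \<forall>j<2 * p. (f i, f j) \<in> parcs G \<longleftrightarrow> i \<noteq> j \<and> i div 2 = j div 2"
    using adj.has_induced_matching_embedding by blast
  then show False
    using family_freeD[OF assms pair_wf_digraph_axioms pair_wf_pK2, of f] by (auto simp: pK2_def)
qed

lemma clique_minus_edge_free_if_K5_minus_e_free:
  assumes "family_free F G" "K5_minus_e \<in> F"
  shows "adj.clique_minus_edge_free 3 (pverts G)"
  unfolding adj.clique_minus_edge_free_def
proof (intro allI ballI impI, elim conjE)
  fix K a b
  assume V: "K \<subseteq> pverts G" "a \<in> pverts G" "b \<in> pverts G" and K: "card K = 3"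
      "pairwise (\<lambda>u v. (u, v) \<in> parcs G) K"
    and ab: "\<forall>x\<in>K. (a, x) \<in> parcs G \<and> (b, x) \<in> parcs G" "a \<noteq> b"
  obtain x y z where xyz: "K = {x, y, z}" "distinct [x, y, z]" using K(1) by (auto simp: card_3_iff)
  have adj: "(x, y) \<in> parcs G" "(x, z) \<in> parcs G" "(y, z) \<in> parcs G" "(a, x) \<in> parcs G"
    "(a, y) \<in> parcs G" "(a, z) \<in> parcs G" "(b, x) \<in> parcs G" "(b, y) \<in> parcs G" "(b, z) \<in> parcs G"
    using K(2) ab(1) xyz by (auto simp: pairwise_def)
  note sym = adj[THEN adj.adj_sym]
  define f where "f = (!) [a, b, x, y, z]"
  have f: "f 0 = a" "f (Suc 0) = b" "f 2 = x" "f 3 = y" "f 4 = z" by (simp_all add: f_def)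
  have vertices: "pverts K5_minus_e = {0, 1, 2, 3, 4}" by (auto simp: K5_minus_e_def)
  have "distinct [a, b, x, y, z]" using adj xyz(2) ab(2) adj.adj_irrefl by auto
  then have "inj_on f (pverts K5_minus_e)" "f ` pverts K5_minus_e \<subseteq> pverts G"
    unfolding vertices using V xyz(1) by (auto simp: inj_on_def f)
  from family_freeD[OF assms pair_wf_digraph_axioms pair_wf_K5_minus_e this]
  show "(a, b) \<in> parcs G"
    unfolding vertices using adj sym adj.adj_irrefl adj.adj_commute[of b a]
    by (auto simp: f K5_minus_e_def)
qed

lemma clique_in_iff: "clique_in G K \<longleftrightarrow> K \<subseteq> pverts G \<and> pairwise (\<lambda>u v. (u, v) \<in> parcs G) K"
  by (simp add: clique_in_def pairwise_def)

lemma finite_cliques: "finite {K. clique_in G K}"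
  by (rule finite_subset[of _ "Pow (pverts G)"]) (auto simp: clique_in_def)

lemma has_clique_clique_number: "adj.has_clique (clique_number G) (pverts G)"
proof -
  have "{} \<in> {K. clique_in G K}" by (simp add: clique_in_def)
  then have "clique_number G \<in> card ` {K. clique_in G K}"
    unfolding clique_number_def using finite_cliques by (intro Max_in) auto
  then obtain K where K: "clique_in G K" "card K = clique_number G" by auto
  then show ?thesis
    using finite_subset[of K "pverts G"] by (intro adj.has_cliqueI) (auto simp: clique_in_iff)
qed

lemma not_has_clique_Suc_clique_number: "\<not> adj.has_clique (Suc (clique_number G)) (pverts G)"
proof
  assume "adj.has_clique (Suc (clique_number G)) (pverts G)"
  then obtain K where K: "clique_in G K" and card: "card K = Suc (clique_number G)"
    unfolding clique_in_iff by (rule adj.has_cliqueE) blast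
  have "card K \<le> clique_number G"
    unfolding clique_number_def using K finite_cliques by (intro Max_ge) auto
  then show False using card by simp
qed

lemma chromatic_number_le:
  assumes "adj.colorable (pverts G) k"
  shows "chromatic_number G \<le> k"
proof -
  obtain c where "proper_coloring G k c"
    using assms in_arcsD1 in_arcsD2 unfolding adj.colorable_def proper_coloring_def by blast
  then show ?thesis unfolding chromatic_number_def by (intro Least_le) blast
qed

end

theorem theorem3p7:
  fixes G :: "'a pair_pre_digraph" and p :: nat
  assumes "p \<ge> 2"
    and "pair_graph G"
    and "family_free {pK2 p, K5_minus_e} G"
  shows "chromatic_number G \<le> fbound p (clique_number G)"
proof -
  interpret pair_graph G by (rule assms(2))
  have "\<not> adj.has_induced_matching p (pverts G)" "adj.clique_minus_edge_free 3 (pverts G)"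
    using not_has_induced_matching_if_pK2_free clique_minus_edge_free_if_K5_minus_e_free assms(3)
    by blast+
  then have "adj.colorable (pverts G) (fbound p (clique_number G))"
    using adj.colorable_fbound[OF assms(1) pair_finite_verts] has_clique_clique_number
      not_has_clique_Suc_clique_number by blast
  then show ?thesis by (rule chromatic_number_le)
qed

end
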